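(* Let $\mathcal{C}^{\mathbb{C}}=\{\mathscr{C}_1,\dots,\mathscr{C}_m\}$ be an algebraic curve arrangement in $\mathbb{C}^2$, with complement $\mathcal{M}(\mathcal{C}^{\mathbb{C}})=\mathbb{C}^2\setminus\bigcup_{i=1}^m\mathscr{C}_i$. Assume that there is no node of multiplicity $k_x=3$ (equivalently, every node satisfies $k_x=2$ or $k_x\ge4$). Then the canonical homomorphism $\Phi:E\to H^*(\mathcal{M}(\mathcal{C}^{\mathbb{C}});\mathbb{C})$ satisfies $\Phi(I)=0$. Consequently $\Phi$ factors through the quotient $OS(\mathcal{C}^{\mathbb{C}})=E/I$.
   Context: The curves $\mathscr{C}_i=\{f_i=0\}$ are distinct irreducible curves in $\mathbb{C}^2$ given by reduced polynomials $f_i$. A node is a point of $\mathbb{C}^2$ lying on at least two of the curves; $k_x$ is the number of curves $\mathscr{C}_i$ passing through the node $x$. $E=\bigwedge_{\mathbb{C}}\langle e_1,\dots,e_m\rangle$ is the free graded exterior algebra with one degree-one generator $e_i$ per curve. The Koszul derivative $\partial:E\to E$ is the linear map of degree $-1$ with $\partial(1)=0$, $\partial(e_i)=1$ and $\partial(\alpha\wedge\beta)=\partial(\alpha)\wedge\beta+(-1)^p\alpha\wedge\partial(\beta)$ for $\alpha\in E^p$. For a node $x$ with $k_x\ge3$ lying on exactly the curves with indices $i_1<\dots<i_k$, put $e_D=e_{i_1}\wedge\dots\wedge e_{i_k}$ (one such monomial per node, using all curves through the node). The ideal of relations is the two-sided homogeneous ideal $I=\langle\partial(e_D)\mid x\text{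 a node with }k_x\ge3\rangle\subset E$, and $OS(\mathcal{C}^{\mathbb{C}})=E/I$ is the Orlik–Solomon type algebra. $\Phi:E\to H^*(\mathcal{M}(\mathcal{C}^{\mathbb{C}});\mathbb{C})$ is the unique graded algebra homomorphism with $\Phi(e_i)=[\omega_i]$, where $\omega_i=df_i/f_i$. *)

theory Defs
  imports
    "HOL-Analysis.Analysis"
    "HOL-Computational_Algebra.Polynomial"
    "HOL-Algebra.QuotRing"
    "HOL-Algebra.Module"
begin

section \<open>Graded algebras over the complex numbers\<close>

text \<open>
  A (not necessarily commutative) complex algebra is a record of type
  \<open>(complex, 'a) module\<close>, i.e. a ring record with a scalar multiplication.  A grading is
  given by the family \<open>G\<close> of its homogeneous parts.
\<close>

definition graded_alg_hom ::
  "(complex, 'a) module \<Rightarrow> (nat \<Rightarrow> 'a set) \<Rightarrow> (complex, 'b) module \<Rightarrow> (nat \<Rightarrow> 'b set)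
     \<Rightarrow> ('a \<Rightarrow> 'b) \<Rightarrow> bool" where
  "graded_alg_hom A G B H h \<longleftrightarrow>
     h \<in> ring_hom A B \<and>
     (\<forall>c. \<forall>x\<in>carrier A. h (c \<odot>\<^bsub>A\<^esub> x) = c \<odot>\<^bsub>B\<^esub> h x) \<and>
     (\<forall>p. h ` G p \<subseteq> H p)"

definition alg_quot ::
  "(complex, 'a) module \<Rightarrow> 'a set \<Rightarrow> (complex, 'a set) module" where
  "alg_quot A I =
     \<lparr>carrier = carrier (A Quot I), mult = mult (A Quot I), one = one (A Quot I),
      zero = zero (A Quot I), add = add (A Quot I),
      smult = (\<lambda>c X. \<Union>x\<in>X. I +>\<^bsub>A\<^esub> (c \<odot>\<^bsub>A\<^esub> x))\<rparr>"

definition quot_grading ::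
  "(complex, 'a) module \<Rightarrow> 'a set \<Rightarrow> (nat \<Rightarrow> 'a set) \<Rightarrow> nat \<Rightarrow> 'a set set" where
  "quot_grading A I G p = (\<lambda>x. I +>\<^bsub>A\<^esub> x) ` G p"


section \<open>Exterior algebra\<close>

text \<open>
  An element \<open>a\<close> of the exterior algebra on generators \<open>e\<^sub>0, \<dots>, e\<^sub>m\<^sub>-\<^sub>1\<close> is represented by its
  coefficients: \<open>a S\<close> is the coefficient of the monomial \<open>e\<^sub>S = e\<^sub>i\<^sub>1 \<and> \<dots> \<and> e\<^sub>i\<^sub>k\<close>,
  \<open>S = {i\<^sub>1 < \<dots> < i\<^sub>k}\<close>.  For disjoint \<open>S\<close> and \<open>T\<close> one has
  \<open>e\<^sub>S \<and> e\<^sub>T = ext_sign S T \<cdot> e\<^sub>S\<^sub>\<union>\<^sub>T\<close>: the sign counts the inversions.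
\<close>

definition ext_sign :: "nat set \<Rightarrow> nat set \<Rightarrow> complex" where
  "ext_sign S T = (\<Prod>s\<in>S. \<Prod>t\<in>T. if t < s then - 1 else 1)"

definition ext_mult ::
  "(nat set \<Rightarrow> complex) \<Rightarrow> (nat set \<Rightarrow> complex) \<Rightarrow> nat set \<Rightarrow> complex" where
  "ext_mult a b S = (\<Sum>T\<in>Pow S. ext_sign T (S - T) * a T * b (S - T))"

definition ext_monom :: "nat set \<Rightarrow> nat set \<Rightarrow> complex" where
  "ext_monom S = (\<lambda>T. if T = S then 1 else 0)"

definition ext_alg :: "nat \<Rightarrow> (complex, nat set \<Rightarrow> complex) module" where
  "ext_alg m =
     \<lparr>carrier = {a. \<forall>S. \<not> S \<subseteq> {..<m} \<longrightarrow> a S = 0},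
      mult = ext_mult, one = ext_monom {}, zero = (\<lambda>S. 0), add = (\<lambda>a b S. a S + b S),
      smult = (\<lambda>c a S. c * a S)\<rparr>"

definition ext_grading :: "nat \<Rightarrow> nat \<Rightarrow> (nat set \<Rightarrow> complex) set" where
  "ext_grading m p = {a \<in> carrier (ext_alg m). \<forall>S. card S \<noteq> p \<longrightarrow> a S = 0}"

text \<open>
  The Koszul derivative, in coefficients: \<open>\<partial> e\<^sub>R = (\<Sum>i\<in>R. ext_sign {i} (R - {i}) \<cdot> e\<^bsub>R - {i}\<^esub>)\<close>.
  The lemmas at the end of this theory show that it is the degree \<open>-1\<close> antiderivation
  with \<open>\<partial> 1 = 0\<close> and \<open>\<partial> e\<^sub>i = 1\<close>.
\<close>

definition koszul :: "nat \<Rightarrow> (nat set \<Rightarrow> complex) \<Rightarrow> nat set \<Rightarrow> complex" where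
  "koszul m a S = (\<Sum>i\<in>{..<m} - S. ext_sign {i} S * a (insert i S))"


section \<open>Complex-valued de Rham cohomology of an open subset of \<open>\<complex>\<^sup>2\<close>\<close>

text \<open>
  The plane is regarded as real four-dimensional space with coordinates
  \<open>x\<^sub>0 = Re z, x\<^sub>1 = Im z, x\<^sub>2 = Re w, x\<^sub>3 = Im w\<close>.  An inhomogeneous differential form
  \<open>(\<Sum>S\<subseteq>{0,1,2,3}. \<omega>\<^sub>S dx\<^sub>S)\<close> on \<open>U\<close> with smooth complex coefficients is the function taking
  a point \<open>x\<close> to the coefficients \<open>\<omega> x S = \<omega>\<^sub>S(x)\<close>, extended by zero outside \<open>U\<close>.
\<close>

type_synonym pt = "complex \<times> complex"
type_synonym dform = "pt \<Rightarrow> nat set \<Rightarrow> complex"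

definition coord_vec :: "nat \<Rightarrow> pt" where
  "coord_vec j = [(1, 0), (\<i>, 0), (0, 1), (0, \<i>)] ! j"

definition pderiv_coord :: "nat \<Rightarrow> (pt \<Rightarrow> complex) \<Rightarrow> pt \<Rightarrow> complex" where
  "pderiv_coord j g x = frechet_derivative g (at x) (coord_vec j)"

primrec C_k_on :: "nat \<Rightarrow> pt set \<Rightarrow> (pt \<Rightarrow> complex) \<Rightarrow> bool" where
  "C_k_on 0 U g = continuous_on U g"
| "C_k_on (Suc k) U g =
     ((\<forall>x\<in>U. g differentiable (at x)) \<and> (\<forall>j<4. C_k_on k U (pderiv_coord j g)))"

definition C_infinity_on :: "pt set \<Rightarrow> (pt \<Rightarrow> complex) \<Rightarrow> bool" where
  "C_infinity_on U g \<longleftrightarrow> (\<forall>k. C_k_on k U g)"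

definition forms :: "pt set \<Rightarrow> dform set" where
  "forms U = {\<omega>. (\<forall>x S. x \<notin> U \<or> \<not> S \<subseteq> {..<4} \<longrightarrow> \<omega> x S = 0) \<and>
                  (\<forall>S\<subseteq>{..<4}. C_infinity_on U (\<lambda>x. \<omega> x S))}"

definition ext_deriv :: "pt set \<Rightarrow> dform \<Rightarrow> dform" where
  "ext_deriv U \<omega> x S =
     (if x \<in> U \<and> S \<subseteq> {..<4}
      then \<Sum>j\<in>S. ext_sign {j} (S - {j}) * pderiv_coord j (\<lambda>y. \<omega> y (S - {j})) x
      else 0)"

definition closed_forms :: "pt set \<Rightarrow> (complex, dform) module" where
  "closed_forms U =
     \<lparr>carrier = {\<omega> \<in> forms U. ext_deriv U \<omega> = (\<lambda>x S. 0)},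
      mult = (\<lambda>\<alpha> \<beta> x. ext_mult (\<alpha> x) (\<beta> x)),
      one = (\<lambda>x. if x \<in> U then ext_monom {} else (\<lambda>S. 0)),
      zero = (\<lambda>x S. 0), add = (\<lambda>\<alpha> \<beta> x S. \<alpha> x S + \<beta> x S),
      smult = (\<lambda>c \<alpha> x S. c * \<alpha> x S)\<rparr>"

definition closed_grading :: "pt set \<Rightarrow> nat \<Rightarrow> dform set" where
  "closed_grading U p = {\<omega> \<in> carrier (closed_forms U). \<forall>x S. card S \<noteq> p \<longrightarrow> \<omega> x S = 0}"

definition exact_forms :: "pt set \<Rightarrow> dform set" where
  "exact_forms U = ext_deriv U ` forms U"

definition cohom :: "pt set \<Rightarrow> (complex, dform set) module" where
  "cohom U = alg_quot (closed_forms U) (exact_forms U)"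

definition cohom_grading :: "pt set \<Rightarrow> nat \<Rightarrow> dform set set" where
  "cohom_grading U = quot_grading (closed_forms U) (exact_forms U) (closed_grading U)"

definition cohom_class :: "pt set \<Rightarrow> dform \<Rightarrow> dform set" where
  "cohom_class U \<omega> = exact_forms U +>\<^bsub>closed_forms U\<^esub> \<omega>"

definition zero_form :: "pt set \<Rightarrow> (pt \<Rightarrow> complex) \<Rightarrow> dform" where
  "zero_form U g x S = (if x \<in> U \<and> S = {} then g x else 0)"


section \<open>Curve arrangements in \<open>\<complex>\<^sup>2\<close>\<close>

text \<open>
  A polynomial in \<open>z, w\<close> is an element of \<open>\<complex>[z][w]\<close>; the outer variable is \<open>w\<close>.
\<close>

definition eval2 :: "complex poly poly \<Rightarrow> pt \<Rightarrow> complex" where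
  "eval2 p x = poly (poly p [:snd x:]) (fst x)"

definition curve :: "complex poly poly \<Rightarrow> pt set" where
  "curve p = {x. eval2 p x = 0}"

text \<open>The arrangement consists of the curves of \<open>f 0, \<dots>, f (m - 1)\<close>.\<close>

definition curve_arrangement :: "nat \<Rightarrow> (nat \<Rightarrow> complex poly poly) \<Rightarrow> bool" where
  "curve_arrangement m f \<longleftrightarrow>
     (\<forall>i<m. irreducible (f i)) \<and> inj_on (\<lambda>i. curve (f i)) {..<m}"

definition arr_complement :: "nat \<Rightarrow> (nat \<Rightarrow> complex poly poly) \<Rightarrow> pt set" where
  "arr_complement m f = UNIV - (\<Union>i<m. curve (f i))"

definition curves_through :: "nat \<Rightarrow> (nat \<Rightarrow> complex poly poly) \<Rightarrow> pt \<Rightarrow> nat set" where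
  "curves_through m f x = {i. i < m \<and> x \<in> curve (f i)}"

definition node_mult :: "nat \<Rightarrow> (nat \<Rightarrow> complex poly poly) \<Rightarrow> pt \<Rightarrow> nat" where
  "node_mult m f x = card (curves_through m f x)"

definition is_node :: "nat \<Rightarrow> (nat \<Rightarrow> complex poly poly) \<Rightarrow> pt \<Rightarrow> bool" where
  "is_node m f x \<longleftrightarrow> 2 \<le> node_mult m f x"

definition relation_ideal ::
  "nat \<Rightarrow> (nat \<Rightarrow> complex poly poly) \<Rightarrow> (nat set \<Rightarrow> complex) set" where
  "relation_ideal m f =
     genideal (ext_alg m)
       {koszul m (ext_monom (curves_through m f x)) | x. is_node m f x \<and> 3 \<le> node_mult m f x}"

definition OS_alg ::
  "nat \<Rightarrow> (nat \<Rightarrow> complex poly poly) \<Rightarrow> (complex, (nat set \<Rightarrow> complex) set) module" where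
  "OS_alg m f = alg_quot (ext_alg m) (relation_ideal m f)"

definition OS_grading ::
  "nat \<Rightarrow> (nat \<Rightarrow> complex poly poly) \<Rightarrow> nat \<Rightarrow> (nat set \<Rightarrow> complex) set set" where
  "OS_grading m f = quot_grading (ext_alg m) (relation_ideal m f) (ext_grading m)"

definition log_form :: "pt set \<Rightarrow> complex poly poly \<Rightarrow> dform" where
  "log_form U p x S = ext_deriv U (zero_form U (eval2 p)) x S / eval2 p x"

text \<open>
  The unique graded algebra homomorphism from the exterior algebra to the cohomology of the
  complement with \<open>e\<^sub>i \<mapsto> [df\<^sub>i / f\<^sub>i]\<close>.  Functions in HOL are total, so extensionality outside
  the carrier is needed for uniqueness.
\<close>

definition canonical_hom ::
  "nat \<Rightarrow> (nat \<Rightarrow> complex poly poly) \<Rightarrow> (nat set \<Rightarrow> complex) \<Rightarrow> dform set" where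
  "canonical_hom m f =
     (let U = arr_complement m f in
      THE \<Phi>. \<Phi> \<in> extensional (carrier (ext_alg m)) \<and>
        graded_alg_hom (ext_alg m) (ext_grading m) (cohom U) (cohom_grading U) \<Phi> \<and>
        (\<forall>i<m. \<Phi> (ext_monom {i}) = cohom_class U (log_form U (f i))))"


section \<open>The Koszul derivative is an antiderivation\<close>

lemma ext_alg_carrier_iff:
  "a \<in> carrier (ext_alg m) \<longleftrightarrow> (\<forall>S. \<not> S \<subseteq> {..<m} \<longrightarrow> a S = 0)"
  by (simp add: ext_alg_def)

lemma ext_sign_insert_left:
  "finite S \<Longrightarrow> i \<notin> S \<Longrightarrow> ext_sign (insert i S) T = ext_sign {i} T * ext_sign S T"
  by (simp add: ext_sign_def)

lemma ext_sign_insert_right: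
  "finite T \<Longrightarrow> j \<notin> T \<Longrightarrow> ext_sign S (insert j T) = ext_sign S {j} * ext_sign S T"
  by (simp add: ext_sign_def prod.distrib)

lemma ext_sign_union_right:
  "finite T \<Longrightarrow> finite U \<Longrightarrow> T \<inter> U = {} \<Longrightarrow>
    ext_sign {i} (T \<union> U) = ext_sign {i} T * ext_sign {i} U"
  by (simp add: ext_sign_def prod.union_disjoint)

lemma ext_sign_square: "ext_sign S T * ext_sign S T = 1"
proof -
  have "ext_sign S T * ext_sign S T =
      (\<Prod>s\<in>S. \<Prod>t\<in>T. (if t < s then - 1 else 1) * (if t < s then - 1 else 1))"
    by (simp add: ext_sign_def prod.distrib)
  also have "\<dots> = 1" by (intro prod.neutral ballI) auto
  finally show ?thesis .
qed

lemma ext_sign_swap: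
  assumes "finite T" "i \<notin> T"
  shows "ext_sign {i} T * ext_sign T {i} = (- 1) ^ card T"
proof -
  have "ext_sign {i} T * ext_sign T {i} =
      (\<Prod>t\<in>T. (if t < i then - 1 else 1) * (if i < t then - 1 else 1))"
    by (simp add: ext_sign_def prod.distrib)
  also have "\<dots> = (\<Prod>t\<in>T. - 1)"
  proof (rule prod.cong[OF refl])
    fix t assume "t \<in> T"
    then have "t \<noteq> i" using assms by auto
    then show "(if t < i then - 1 else 1) * (if i < t then - 1 else 1) = (- 1 :: complex)"
      by auto
  qed
  finally show ?thesis by simp
qed

lemma koszul_add: "koszul m (\<lambda>S. a S + b S) = (\<lambda>S. koszul m a S + koszul m b S)"
  by (simp add: koszul_def fun_eq_iff distrib_left sum.distrib)

lemma koszul_smult: "koszul m (\<lambda>S. c * a S) = (\<lambda>S. c * koszul m a S)"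
  by (simp add: koszul_def fun_eq_iff sum_distrib_left mult.left_commute)

lemma koszul_one: "koszul m (ext_monom {}) = (\<lambda>S. 0)"
  by (simp add: koszul_def ext_monom_def fun_eq_iff)

lemma koszul_gen:
  assumes "i < m"
  shows "koszul m (ext_monom {i}) = ext_monom {}"
proof
  fix S
  have *: "j \<notin> S \<Longrightarrow> insert j S = {i} \<longleftrightarrow> j = i \<and> S = {}" for j by auto
  have "koszul m (ext_monom {i}) S =
      (\<Sum>j\<in>{..<m} - S. if j = i then if S = {} then 1 else 0 else 0)"
    unfolding koszul_def ext_monom_def by (intro sum.cong) (auto simp: * ext_sign_def)
  also have "\<dots> = ext_monom {} S" using assms by (auto simp: ext_monom_def)
  finally show "koszul m (ext_monom {i}) S = ext_monom {} S" .
qed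

lemma koszul_closed:
  "a \<in> carrier (ext_alg m) \<Longrightarrow> koszul m a \<in> carrier (ext_alg m)"
  by (auto simp: ext_alg_carrier_iff koszul_def intro!: sum.neutral)

lemma koszul_degree:
  assumes "a \<in> ext_grading m (Suc p)"
  shows "koszul m a \<in> ext_grading m p"
proof -
  have a: "a \<in> carrier (ext_alg m)" "\<And>S. card S \<noteq> Suc p \<Longrightarrow> a S = 0"
    using assms by (auto simp: ext_grading_def)
  have "koszul m a S = 0" if S: "card S \<noteq> p" for S
  proof (cases "finite S")
    case True
    then show ?thesis using S unfolding koszul_def
      by (intro sum.neutral ballI) (simp add: a(2))
  next
    case False
    then show ?thesis unfolding koszul_def
      by (intro sum.neutral ballI) (simp add: a(2))
  qed
  with koszul_closed[OF a(1)] show ?thesis by (simp add: ext_grading_def)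
qed

lemma koszul_degree_0:
  assumes "a \<in> ext_grading m 0"
  shows "koszul m a = (\<lambda>S. 0)"
proof
  fix S
  have a: "\<And>S. card S \<noteq> 0 \<Longrightarrow> a S = 0" "\<And>S. \<not> S \<subseteq> {..<m} \<Longrightarrow> a S = 0"
    using assms by (auto simp: ext_grading_def ext_alg_carrier_iff)
  have "a (insert i S) = 0" for i
  proof (cases "finite S")
    case True
    then show ?thesis by (intro a(1)) (simp add: card_gt_0_iff)
  next
    case False
    then have "\<not> insert i S \<subseteq> {..<m}" by (meson finite_insert finite_lessThan finite_subset)
    then show ?thesis by (rule a(2))
  qed
  then show "koszul m a S = 0" by (simp add: koszul_def)
qed

lemma koszul_leibniz:
  assumes a: "a \<in> ext_grading m p" and b: "b \<in> carrier (ext_alg m)"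
  shows "koszul m (ext_mult a b) =
    (\<lambda>S. ext_mult (koszul m a) b S + (- 1) ^ p * ext_mult a (koszul m b) S)"
proof
  fix S
  let ?N = "{..<m}"
  have a0: "\<And>S. \<not> S \<subseteq> ?N \<Longrightarrow> a S = 0" and ap: "\<And>S. card S \<noteq> p \<Longrightarrow> a S = 0"
    using a by (auto simp: ext_grading_def ext_alg_carrier_iff)
  have b0: "\<And>S. \<not> S \<subseteq> ?N \<Longrightarrow> b S = 0" using b by (auto simp: ext_alg_carrier_iff)
  have ka: "\<And>S. \<not> S \<subseteq> ?N \<Longrightarrow> koszul m a S = 0" and kb: "\<And>S. \<not> S \<subseteq> ?N \<Longrightarrow> koszul m b S = 0"
    using koszul_closed[of a m] koszul_closed[of b m] a b
    by (auto simp: ext_grading_def ext_alg_carrier_iff)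
  have out: "ext_mult u v R = 0"
    if "\<not> R \<subseteq> ?N" "\<And>S. \<not> S \<subseteq> ?N \<Longrightarrow> u S = 0" "\<And>S. \<not> S \<subseteq> ?N \<Longrightarrow> v S = 0" for u v R
    unfolding ext_mult_def
  proof (rule sum.neutral, rule ballI)
    fix T assume "T \<in> Pow R"
    then have "\<not> T \<subseteq> ?N \<or> \<not> R - T \<subseteq> ?N" using that(1) by blast
    then have "u T = 0 \<or> v (R - T) = 0" using that(2)[of T] that(3)[of "R - T"] by blast
    then show "ext_sign T (R - T) * u T * v (R - T) = 0" by auto
  qed
  show "koszul m (ext_mult a b) S =
      ext_mult (koszul m a) b S + (- 1) ^ p * ext_mult a (koszul m b) S"
  proof (cases "S \<subseteq> ?N")
    case False
    have "koszul m (ext_mult a b) S = 0" unfolding koszul_def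
      by (intro sum.neutral ballI) (use False out[OF _ a0 b0] in auto)
    then show ?thesis using out[OF False ka b0] out[OF False a0 kb] by simp
  next
    case True
    then have fS: "finite S" by (rule finite_subset) simp
    have fT: "finite T" if "T \<in> Pow S" for T using that fS by (auto intro: finite_subset)
    define F where "F T i = ext_sign T (S - T) * ext_sign {i} T * a (insert i T) * b (S - T)" for T i
    define G where "G T i = (- 1) ^ p * ext_sign T (S - T) * ext_sign {i} (S - T) * a T * b (insert i (S - T))" for T i
    have step: "ext_sign {i} S * ext_mult a b (insert i S) = (\<Sum>T\<in>Pow S. F T i + G T i)"
      if i: "i \<in> ?N - S" for i
    proof -
      have iS: "i \<notin> S" using i by auto
      have inj: "inj_on (insert i) (Pow S)" using iS by (auto simp: inj_on_def)
      have "ext_mult a b (insert i S) =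
          (\<Sum>T\<in>Pow S. ext_sign T (insert i S - T) * a T * b (insert i S - T)) +
          (\<Sum>T\<in>insert i ` Pow S. ext_sign T (insert i S - T) * a T * b (insert i S - T))"
        unfolding ext_mult_def Pow_insert
        by (rule sum.union_disjoint) (use fS iS in auto)
      also have "(\<Sum>T\<in>insert i ` Pow S. ext_sign T (insert i S - T) * a T * b (insert i S - T))
          = (\<Sum>T\<in>Pow S. ext_sign (insert i T) (insert i S - insert i T) * a (insert i T)
               * b (insert i S - insert i T))"
        by (simp add: sum.reindex[OF inj])
      finally have "ext_sign {i} S * ext_mult a b (insert i S) =
          (\<Sum>T\<in>Pow S. ext_sign {i} S * (ext_sign (insert i T) (insert i S - insert i T) *
               a (insert i T) * b (insert i S - insert i T)) +
             ext_sign {i} S * (ext_sign T (insert i S - T) * a T * b (insert i S - T)))"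
        by (simp add: sum.distrib distrib_left sum_distrib_left add.commute)
      also have "\<dots> = (\<Sum>T\<in>Pow S. F T i + G T i)"
      proof (rule sum.cong[OF refl])
        fix T assume T: "T \<in> Pow S"
        let ?W = "S - T"
        have fin: "finite T" "finite ?W" using fT[OF T] fS by auto
        have iT: "i \<notin> T" "i \<notin> ?W" using T iS by auto
        have e1: "insert i S - insert i T = ?W" "insert i S - T = insert i ?W" using iS T by auto
        have s: "ext_sign {i} S = ext_sign {i} T * ext_sign {i} ?W"
          using ext_sign_union_right[OF fin, of i] T by (simp add: Un_absorb1)
        have A: "ext_sign {i} S * ext_sign (insert i T) ?W = ext_sign T ?W * ext_sign {i} T"
          using ext_sign_square[of "{i}" ?W]
          by (simp add: s ext_sign_insert_left[OF fin(1) iT(1)] mult_ac)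
        have "ext_sign {i} S * ext_sign T (insert i ?W) =
            (ext_sign {i} T * ext_sign T {i}) * ext_sign T ?W * ext_sign {i} ?W"
          by (simp add: s ext_sign_insert_right[OF fin(2) iT(2)] mult_ac)
        then have B: "ext_sign {i} S * ext_sign T (insert i ?W) =
            (- 1) ^ card T * ext_sign T ?W * ext_sign {i} ?W"
          by (simp add: ext_sign_swap[OF fin(1) iT(1)])
        have "ext_sign {i} S * (ext_sign (insert i T) ?W * a (insert i T) * b ?W) = F T i"
          unfolding F_def by (simp only: A mult.assoc[symmetric])
        moreover have "ext_sign {i} S * (ext_sign T (insert i ?W) * a T * b (insert i ?W)) = G T i"
        proof (cases "card T = p")
          case True
          then show ?thesis unfolding G_def by (simp only: B mult.assoc[symmetric])
        next
          case False
          then show ?thesis unfolding G_def by (simp add: ap)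
        qed
        ultimately show "ext_sign {i} S * (ext_sign (insert i T) (insert i S - insert i T) *
               a (insert i T) * b (insert i S - insert i T)) +
             ext_sign {i} S * (ext_sign T (insert i S - T) * a T * b (insert i S - T)) = F T i + G T i"
          by (simp only: e1)
      qed
      finally show ?thesis .
    qed
    have L: "koszul m (ext_mult a b) S = (\<Sum>T\<in>Pow S. \<Sum>i\<in>?N - S. F T i + G T i)"
    proof -
      have "koszul m (ext_mult a b) S = (\<Sum>i\<in>?N - S. \<Sum>T\<in>Pow S. F T i + G T i)"
        unfolding koszul_def by (rule sum.cong[OF refl]) (rule step)
      also have "\<dots> = (\<Sum>T\<in>Pow S. \<Sum>i\<in>?N - S. F T i + G T i)" by (rule sum.swap)
      finally show ?thesis .
    qed
    have R1: "ext_mult (koszul m a) b S =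
        (\<Sum>T\<in>Pow S. \<Sum>i\<in>?N - S. F T i) + (\<Sum>T\<in>Pow S. \<Sum>i\<in>S - T. F T i)"
    proof -
      have "ext_mult (koszul m a) b S = (\<Sum>T\<in>Pow S. \<Sum>i\<in>?N - T. F T i)"
        unfolding ext_mult_def koszul_def F_def
        by (simp add: sum_distrib_left sum_distrib_right mult.assoc)
      also have "\<dots> = (\<Sum>T\<in>Pow S. (\<Sum>i\<in>?N - S. F T i) + (\<Sum>i\<in>S - T. F T i))"
      proof (rule sum.cong[OF refl])
        fix T assume "T \<in> Pow S"
        then have "?N - T = (?N - S) \<union> (S - T)" using True by auto
        moreover have "(?N - S) \<inter> (S - T) = {}" by auto
        ultimately show "(\<Sum>i\<in>?N - T. F T i) = (\<Sum>i\<in>?N - S. F T i) + (\<Sum>i\<in>S - T. F T i)"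
          using fS by (simp add: sum.union_disjoint)
      qed
      finally show ?thesis by (simp add: sum.distrib)
    qed
    have R2: "(- 1) ^ p * ext_mult a (koszul m b) S =
        (\<Sum>T\<in>Pow S. \<Sum>i\<in>?N - S. G T i) + (\<Sum>T\<in>Pow S. \<Sum>i\<in>T. G T i)"
    proof -
      have "(- 1) ^ p * ext_mult a (koszul m b) S = (\<Sum>T\<in>Pow S. \<Sum>i\<in>?N - (S - T). G T i)"
        unfolding ext_mult_def koszul_def G_def
        by (simp add: sum_distrib_left sum_distrib_right mult_ac)
      also have "\<dots> = (\<Sum>T\<in>Pow S. (\<Sum>i\<in>?N - S. G T i) + (\<Sum>i\<in>T. G T i))"
      proof (rule sum.cong[OF refl])
        fix T assume T: "T \<in> Pow S"
        then have "?N - (S - T) = (?N - S) \<union> T" using True by auto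
        moreover have "(?N - S) \<inter> T = {}" using T by auto
        ultimately show "(\<Sum>i\<in>?N - (S - T). G T i) = (\<Sum>i\<in>?N - S. G T i) + (\<Sum>i\<in>T. G T i)"
          using fT[OF T] by (simp add: sum.union_disjoint)
      qed
      finally show ?thesis by (simp add: sum.distrib)
    qed
    have C: "(\<Sum>T\<in>Pow S. \<Sum>i\<in>S - T. F T i) + (\<Sum>T\<in>Pow S. \<Sum>i\<in>T. G T i) = 0"
    proof -
      let ?P = "SIGMA T:Pow S. S - T" and ?Q = "SIGMA T:Pow S. T"
      have "(\<Sum>T\<in>Pow S. \<Sum>i\<in>T. G T i) = (\<Sum>(T, i)\<in>?Q. G T i)"
        by (rule sum.Sigma) (use fS fT in auto)
      also have "\<dots> = (\<Sum>(T, i)\<in>?P. G (insert i T) i)"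
        by (rule sum.reindex_bij_witness[of _ "\<lambda>(T, i). (insert i T, i)" "\<lambda>(T, i). (T - {i}, i)"])
           (auto simp: insert_absorb)
      also have "\<dots> = (\<Sum>(T, i)\<in>?P. - F T i)"
      proof (rule sum.cong[OF refl], clarify)
        fix T i assume T: "T \<subseteq> S" and i: "i \<in> S" "i \<notin> T"
        let ?W = "S - insert i T"
        have fin: "finite T" "finite ?W" using fT[of T] T fS by auto
        have e: "S - T = insert i ?W" using i by auto
        have iW: "i \<notin> ?W" by auto
        show "G (insert i T) i = - F T i"
        proof (cases "card (insert i T) = p")
          case False
          then show ?thesis unfolding F_def G_def by (simp add: ap)
        next
          case True
          then have p: "p = Suc (card T)" using fin i by simp
          have g: "ext_sign (insert i T) ?W * ext_sign {i} ?W = ext_sign T ?W"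
            using ext_sign_square[of "{i}" ?W]
            by (simp add: ext_sign_insert_left[OF fin(1) i(2)] mult_ac)
          have "ext_sign T (insert i ?W) * ext_sign {i} T =
              (ext_sign {i} T * ext_sign T {i}) * ext_sign T ?W"
            by (simp add: ext_sign_insert_right[OF fin(2) iW] mult_ac)
          then have f: "ext_sign T (insert i ?W) * ext_sign {i} T = (- 1) ^ card T * ext_sign T ?W"
            by (simp add: ext_sign_swap[OF fin(1) i(2)])
          have "G (insert i T) i = (- 1) ^ p * (ext_sign (insert i T) ?W * ext_sign {i} ?W) *
              a (insert i T) * b (insert i ?W)"
            unfolding G_def by (simp add: mult.assoc)
          moreover have "F T i = (ext_sign T (insert i ?W) * ext_sign {i} T) *
              a (insert i T) * b (insert i ?W)"
            unfolding F_def e by (simp add: mult.assoc)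
          ultimately show ?thesis unfolding g f p by simp
        qed
      qed
      also have "\<dots> = - (\<Sum>(T, i)\<in>?P. F T i)"
        by (simp add: case_prod_unfold sum_negf)
      also have "(\<Sum>(T, i)\<in>?P. F T i) = (\<Sum>T\<in>Pow S. \<Sum>i\<in>S - T. F T i)"
        by (rule sum.Sigma[symmetric]) (use fS in auto)
      finally show ?thesis by simp
    qed
    show ?thesis using C unfolding L R1 R2 by (simp add: sum.distrib algebra_simps)
  qed
qed

end

theory Submission
  imports Defs
begin

text \<open>
  A logarithmic form \<open>df\<^sub>i / f\<^sub>i\<close> is a combination of \<open>dz\<close> and \<open>dw\<close> at every point, because \<open>f\<^sub>i\<close> is
  holomorphic.  On a complex surface the product of any three such forms is zero, not merely
  exact (\<open>ordered_prod_vanish\<close>).  A node with \<open>k\<^sub>x \<ge> 4\<close> gives a relation \<open>\<partial>(e\<^sub>D)\<close> of degree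
  \<open>k\<^sub>x - 1 \<ge> 3\<close>, which is a combination of products of at least three generators.  Hence
  \<open>\<Phi>(\<partial>(e\<^sub>D)) = 0\<close>, and since the kernel of \<open>\<Phi>\<close> is an ideal, \<open>\<Phi>(I) = 0\<close>.
  
  To use this argument one has to know that \<open>\<Phi>\<close> exists, is unique and is induced by a map on the
  level of forms (\<open>canonical_hom_eq\<close>).  The form-level map comes from the universal property of the
  exterior algebra, applied at each point (\<open>ext_hom_mult\<close>).  It takes values in closed forms, since
  \<open>d\<close> satisfies the Leibniz rule (\<open>ext_deriv_mult\<close>) and logarithmic forms are closed
  (\<open>log_form_closed\<close>).  Cohomology is an algebra because the exact forms are an ideal of the closed
  forms (\<open>ideal_exact_forms\<close>); that exact forms are closed at all rests on the symmetry of second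
  derivatives (\<open>pderiv_coord_commute\<close>).
\<close>

notation ext_mult (infixl "\<cdot>" 70)

section \<open>Multiplication in the exterior algebra\<close>

lemma ext_mult_add_left: "(\<lambda>S. a S + b S) \<cdot> c = (\<lambda>S. (a \<cdot> c) S + (b \<cdot> c) S)"
  by (simp add: ext_mult_def fun_eq_iff sum.distrib algebra_simps)

lemma ext_mult_add_right: "c \<cdot> (\<lambda>S. a S + b S) = (\<lambda>S. (c \<cdot> a) S + (c \<cdot> b) S)"
  by (simp add: ext_mult_def fun_eq_iff sum.distrib algebra_simps)

lemma ext_mult_scale_left: "(\<lambda>S. k * a S) \<cdot> c = (\<lambda>S. k * (a \<cdot> c) S)"
  by (simp add: ext_mult_def fun_eq_iff sum_distrib_left mult_ac)

lemma ext_mult_scale_right: "c \<cdot> (\<lambda>S. k * a S) = (\<lambda>S. k * (c \<cdot> a) S)"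
  by (simp add: ext_mult_def fun_eq_iff sum_distrib_left mult_ac)

lemma ext_mult_zero_left [simp]: "(\<lambda>S. 0) \<cdot> c = (\<lambda>S. 0)"
  by (simp add: ext_mult_def fun_eq_iff)

lemma ext_mult_zero_right [simp]: "c \<cdot> (\<lambda>S. 0) = (\<lambda>S. 0)"
  by (simp add: ext_mult_def fun_eq_iff)

lemma ext_mult_sum_left: "(\<lambda>S. \<Sum>i\<in>N. a i S) \<cdot> c = (\<lambda>S. \<Sum>i\<in>N. (a i \<cdot> c) S)"
  by (induct N rule: infinite_finite_induct) (simp_all add: ext_mult_add_left)

lemma ext_mult_sum_right: "c \<cdot> (\<lambda>S. \<Sum>i\<in>N. a i S) = (\<lambda>S. \<Sum>i\<in>N. (c \<cdot> a i) S)"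
  by (induct N rule: infinite_finite_induct) (simp_all add: ext_mult_add_right)

lemma ext_sign_Un_left:
  "finite R \<Longrightarrow> finite Q \<Longrightarrow> R \<inter> Q = {} \<Longrightarrow> ext_sign (R \<union> Q) P = ext_sign R P * ext_sign Q P"
  by (simp add: ext_sign_def prod.union_disjoint)

lemma ext_sign_Un_right:
  "finite R \<Longrightarrow> finite Q \<Longrightarrow> R \<inter> Q = {} \<Longrightarrow> ext_sign P (R \<union> Q) = ext_sign P R * ext_sign P Q"
  by (simp add: ext_sign_def prod.union_disjoint prod.distrib)

lemma ext_sign_empty [simp]: "ext_sign {} S = 1" "ext_sign S {} = 1"
  by (simp_all add: ext_sign_def)

lemma ext_sign_min: "(\<And>s. s \<in> S \<Longrightarrow> i < s) \<Longrightarrow> ext_sign {i} S = 1"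
  by (force simp: ext_sign_def intro!: prod.neutral)

text \<open>
  Both bracketings expand to a sum over the ordered partitions of \<open>S\<close> into three blocks, with
  a sign that counts the inversions between different blocks; this count does not see the
  brackets.  On an infinite \<open>S\<close> every product is \<open>0\<close>, the default value of a sum over an infinite
  set.
\<close>

lemma ext_mult_assoc: "a \<cdot> b \<cdot> c = a \<cdot> (b \<cdot> c)"
proof
  fix S :: "nat set"
  show "(a \<cdot> b \<cdot> c) S = (a \<cdot> (b \<cdot> c)) S"
  proof (cases "finite S")
    case False
    then show ?thesis by (simp add: ext_mult_def)
  next
    case True
    have fin: "finite T" if "T \<subseteq> S" for T using that True by (rule finite_subset)
    have "(a \<cdot> b \<cdot> c) S = (\<Sum>T\<in>Pow S. \<Sum>R\<in>Pow T.
        ext_sign T (S - T) * ext_sign R (T - R) * a R * b (T - R) * c (S - T))"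
      by (simp add: ext_mult_def sum_distrib_left sum_distrib_right mult_ac)
    also have "\<dots> = (\<Sum>(T, R)\<in>(SIGMA T:Pow S. Pow T).
        ext_sign T (S - T) * ext_sign R (T - R) * a R * b (T - R) * c (S - T))"
      by (rule sum.Sigma) (use True fin in auto)
    also have "\<dots> = (\<Sum>(R, Q)\<in>(SIGMA R:Pow S. Pow (S - R)).
        ext_sign R (S - R) * ext_sign Q (S - R - Q) * a R * b Q * c (S - R - Q))"
    proof (rule sum.reindex_bij_witness[of _ "\<lambda>(R, Q). (R \<union> Q, R)" "\<lambda>(T, R). (R, T - R)"], goal_cases)
      case (5 p)
      obtain T R where p: "p = (T, R)" by (cases p)
      with 5 have sub: "R \<subseteq> T" "T \<subseteq> S" by auto
      have f: "finite R" "finite (T - R)" "finite (S - T)" using sub fin by blast+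
      have e: "S - R = (T - R) \<union> (S - T)" "T = R \<union> (T - R)" "S - R - (T - R) = S - T"
        using sub by auto
      have "ext_sign T (S - T) = ext_sign R (S - T) * ext_sign (T - R) (S - T)"
        using ext_sign_Un_left[OF f(1,2), of "S - T"] e(2) by auto
      moreover have "ext_sign R (S - R) = ext_sign R (T - R) * ext_sign R (S - T)"
        using ext_sign_Un_right[OF f(2,3), of R] by (subst e(1)) auto
      ultimately show ?case unfolding p by (simp add: e(3) mult_ac)
    qed auto
    also have "\<dots> = (\<Sum>R\<in>Pow S. \<Sum>Q\<in>Pow (S - R).
        ext_sign R (S - R) * ext_sign Q (S - R - Q) * a R * b Q * c (S - R - Q))"
      by (rule sum.Sigma[symmetric]) (use True in auto)
    also have "\<dots> = (a \<cdot> (b \<cdot> c)) S"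
      by (simp add: ext_mult_def sum_distrib_left sum_distrib_right mult_ac)
    finally show ?thesis .
  qed
qed

lemma ext_mult_one_left:
  assumes "a \<in> carrier (ext_alg m)"
  shows "ext_monom {} \<cdot> a = a"
proof
  fix S
  show "(ext_monom {} \<cdot> a) S = a S"
  proof (cases "finite S")
    case True
    have "(ext_monom {} \<cdot> a) S = (\<Sum>T\<in>Pow S. if T = {} then a S else 0)"
      unfolding ext_mult_def ext_monom_def by (intro sum.cong) auto
    with True show ?thesis by simp
  next
    case False
    then have "a S = 0" using assms by (meson ext_alg_carrier_iff finite_lessThan finite_subset)
    with False show ?thesis by (simp add: ext_mult_def)
  qed
qed

lemma ext_mult_one_right:
  assumes "a \<in> carrier (ext_alg m)"
  shows "a \<cdot> ext_monom {} = a"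
proof
  fix S
  show "(a \<cdot> ext_monom {}) S = a S"
  proof (cases "finite S")
    case True
    have "(a \<cdot> ext_monom {}) S = (\<Sum>T\<in>Pow S. if T = S then a S else 0)"
      unfolding ext_mult_def ext_monom_def by (intro sum.cong) auto
    with True show ?thesis by simp
  next
    case False
    then have "a S = 0" using assms by (meson ext_alg_carrier_iff finite_lessThan finite_subset)
    with False show ?thesis by (simp add: ext_mult_def)
  qed
qed

lemma ext_mult_closed:
  assumes "a \<in> carrier (ext_alg m)" "b \<in> carrier (ext_alg m)"
  shows "a \<cdot> b \<in> carrier (ext_alg m)"
  unfolding ext_alg_carrier_iff ext_mult_def
proof (intro allI impI sum.neutral ballI)
  fix S T assume "\<not> S \<subseteq> {..<m}" "T \<in> Pow S"
  then have "\<not> T \<subseteq> {..<m} \<or> \<not> S - T \<subseteq> {..<m}" by blast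
  then have "a T = 0 \<or> b (S - T) = 0"
    using assms(1)[unfolded ext_alg_carrier_iff, rule_format, of T]
      assms(2)[unfolded ext_alg_carrier_iff, rule_format, of "S - T"] by blast
  then show "ext_sign T (S - T) * a T * b (S - T) = 0" by auto
qed

lemma ext_grading_mult:
  assumes a: "a \<in> ext_grading m p" and b: "b \<in> ext_grading m q"
  shows "a \<cdot> b \<in> ext_grading m (p + q)"
proof -
  have "(a \<cdot> b) S = 0" if "card S \<noteq> p + q" for S
  proof (cases "finite S")
    case True
    show ?thesis unfolding ext_mult_def
    proof (intro sum.neutral ballI)
      fix T assume "T \<in> Pow S"
      then have "card T + card (S - T) = card S"
        using True by (metis Diff_partition PowD card_Un_disjoint Diff_disjoint finite_Diff finite_subset)
      then have "card T \<noteq> p \<or> card (S - T) \<noteq> q" using that by auto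
      then show "ext_sign T (S - T) * a T * b (S - T) = 0"
        using a b by (auto simp: ext_grading_def)
    qed
  qed (simp add: ext_mult_def)
  with a b show ?thesis by (auto simp: ext_grading_def intro: ext_mult_closed)
qed

lemma ext_monom_grading: "S \<subseteq> {..<m} \<Longrightarrow> ext_monom S \<in> ext_grading m (card S)"
  by (auto simp: ext_grading_def ext_alg_carrier_iff ext_monom_def)

lemma one_in_ext_grading: "ext_monom {} \<in> ext_grading m 0"
  using ext_monom_grading[of "{}" m] by simp

definition grade_invol :: "(nat set \<Rightarrow> complex) \<Rightarrow> nat set \<Rightarrow> complex" where
  "grade_invol a S = (- 1) ^ card S * a S"

text \<open>
  With the grade involution, graded commutativity with an element of degree one holds for
  inhomogeneous \<open>b\<close> too.  This is the only commutation rule that the Leibniz rule for the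
  exterior derivative needs.
\<close>

lemma degree_one_swap:
  assumes v: "v \<in> ext_grading m 1"
  shows "v \<cdot> b = grade_invol b \<cdot> v"
proof
  fix S
  show "(v \<cdot> b) S = (grade_invol b \<cdot> v) S"
  proof (cases "finite S")
    case True
    have "(grade_invol b \<cdot> v) S =
        (\<Sum>T\<in>Pow S. ext_sign (S - T) T * ((- 1) ^ card (S - T) * b (S - T)) * v T)"
      unfolding ext_mult_def grade_invol_def
      by (rule sum.reindex_bij_witness[of _ "\<lambda>T. S - T" "\<lambda>T. S - T"])
         (auto simp: double_diff)
    also have "\<dots> = (\<Sum>T\<in>Pow S. ext_sign T (S - T) * v T * b (S - T))"
    proof (rule sum.cong[OF refl])
      fix T assume T: "T \<in> Pow S"
      show "ext_sign (S - T) T * ((- 1) ^ card (S - T) * b (S - T)) * v T =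
          ext_sign T (S - T) * v T * b (S - T)"
      proof (cases "card T = 1")
        case False
        then show ?thesis using v by (simp add: ext_grading_def)
      next
        case 1: True
        then obtain j where j: "T = {j}" by (auto simp: card_1_singleton_iff)
        have sw: "ext_sign {j} (S - T) * ext_sign (S - T) {j} = (- 1) ^ card (S - T)"
          by (rule ext_sign_swap) (use True j in auto)
        have "ext_sign (S - T) T * (- 1) ^ card (S - T) = ext_sign T (S - T)"
          unfolding sw[symmetric] using ext_sign_square[of "S - T" T]
          by (simp add: j mult.left_commute)
        then show ?thesis by (simp add: mult_ac)
      qed
    qed
    finally show ?thesis by (simp add: ext_mult_def)
  qed (simp add: ext_mult_def)
qed

lemma degree_one_anticommute:
  assumes "v \<in> ext_grading m 1" "w \<in> ext_grading m 1"
  shows "v \<cdot> w = (\<lambda>S. - (w \<cdot> v) S)"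
proof -
  have "grade_invol w = (\<lambda>S. - 1 * w S)"
    
  proof
    fix S
    show "grade_invol w S = - 1 * w S"
      using assms(2) by (cases "card S = 1") (auto simp: grade_invol_def ext_grading_def)
  qed
  then show ?thesis
    using degree_one_swap[OF assms(1), of w] ext_mult_scale_left[of "-1" w v] by simp
qed

lemma degree_one_square:
  assumes "v \<in> ext_grading m 1"
  shows "v \<cdot> v = (\<lambda>S. 0)"
proof
  fix S
  have "(v \<cdot> v) S = - (v \<cdot> v) S"
    using degree_one_anticommute[OF assms assms, THEN fun_cong, of S] .
  then show "(v \<cdot> v) S = 0" by (simp add: equal_neg_zero)
qed

lemma ring_ext_alg: "ring (ext_alg m)"
proof (rule ringI)
  show "abelian_group (ext_alg m)"
  proof (rule abelian_groupI)
    fix a assume a: "a \<in> carrier (ext_alg m)"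
    have "(\<lambda>S. - a S) \<in> carrier (ext_alg m)" using a by (simp add: ext_alg_def)
    moreover have "(\<lambda>S. - a S) \<oplus>\<^bsub>ext_alg m\<^esub> a = \<zero>\<^bsub>ext_alg m\<^esub>" by (simp add: ext_alg_def)
    ultimately show "\<exists>y\<in>carrier (ext_alg m). y \<oplus>\<^bsub>ext_alg m\<^esub> a = \<zero>\<^bsub>ext_alg m\<^esub>" by blast
  qed (auto simp: ext_alg_def)
  show "monoid (ext_alg m)"
  proof (rule monoidI)
    fix a assume "a \<in> carrier (ext_alg m)"
    then show "\<one>\<^bsub>ext_alg m\<^esub> \<otimes>\<^bsub>ext_alg m\<^esub> a = a" "a \<otimes>\<^bsub>ext_alg m\<^esub> \<one>\<^bsub>ext_alg m\<^esub> = a"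
      using ext_mult_one_left[of a m] ext_mult_one_right[of a m] by (simp_all add: ext_alg_def)
  next
    fix a b assume "a \<in> carrier (ext_alg m)" "b \<in> carrier (ext_alg m)"
    then show "a \<otimes>\<^bsub>ext_alg m\<^esub> b \<in> carrier (ext_alg m)"
      using ext_mult_closed[of a m b] by (simp add: ext_alg_def)
  qed (auto simp: ext_alg_def ext_monom_def ext_mult_assoc)
qed (simp_all add: ext_alg_def ext_mult_add_left ext_mult_add_right)

section \<open>The universal property of the exterior algebra\<close>

definition ordered_prod :: "(nat \<Rightarrow> nat set \<Rightarrow> complex) \<Rightarrow> nat set \<Rightarrow> nat set \<Rightarrow> complex" where
  "ordered_prod v S = foldr (\<lambda>i a. v i \<cdot> a) (sorted_list_of_set S) (ext_monom {})"

lemma ordered_prod_empty [simp]: "ordered_prod v {} = ext_monom {}"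
  by (simp add: ordered_prod_def)

lemma ordered_prod_insert_min:
  assumes "finite S" "\<And>s. s \<in> S \<Longrightarrow> i < s"
  shows "ordered_prod v (insert i S) = v i \<cdot> ordered_prod v S"
proof -
  have i: "i \<notin> S" using assms(2) by blast
  have "sorted_list_of_set (insert i S) = insort i (sorted_list_of_set S)"
    using assms(1) i by (simp add: sorted_list_of_set_insert)
  also have "\<dots> = i # sorted_list_of_set S"
    by (rule insort_is_Cons) (use assms in \<open>auto intro: less_imp_le\<close>)
  finally show ?thesis by (simp add: ordered_prod_def)
qed

lemma finite_induct_min [consumes 1, case_names empty insert]:
  assumes "finite (S :: nat set)" "P {}"
    and "\<And>i S. finite S \<Longrightarrow> (\<And>s. s \<in> S \<Longrightarrow> i < s) \<Longrightarrow> P S \<Longrightarrow> P (insert i S)"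
  shows "P S"
  using assms(1) by (rule finite_linorder_min_induct) (use assms(2,3) in auto)

lemma ordered_prod_grading:
  assumes "finite S" "\<And>i. i \<in> S \<Longrightarrow> v i \<in> ext_grading m 1"
  shows "ordered_prod v S \<in> ext_grading m (card S)"
  using assms
proof (induct S rule: finite_induct_min)
  case empty
  then show ?case by (simp add: one_in_ext_grading)
next
  case (insert i S)
  then have "i \<notin> S" by blast
  then show ?case using ext_grading_mult[of "v i" m 1 "ordered_prod v S" "card S"] insert
    by (simp add: ordered_prod_insert_min)
qed

text \<open>
  Moving \<open>v i\<close> to its place in the ordered product costs one sign for each factor that it
  passes; if \<open>v i\<close> already occurs, it meets itself and squares to zero.
\<close>

lemma ordered_prod_gen_mult:
  assumes v: "\<And>i. v i \<in> ext_grading m 1" and S: "finite S"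
  shows "v i \<cdot> ordered_prod v S =
    (if i \<in> S then (\<lambda>R. 0) else (\<lambda>R. ext_sign {i} S * ordered_prod v (insert i S) R))"
  using S
proof (induct S rule: finite_induct_min)
  case empty
  show ?case by (simp add: ordered_prod_insert_min[of "{}", simplified])
next
  case (insert b S)
  have ins: "ordered_prod v (insert b S) = v b \<cdot> ordered_prod v S"
    by (rule ordered_prod_insert_min[OF insert(1,2)])
  have bS: "b \<notin> S" using insert(2) by blast
  consider "i < b" | "i = b" | "b < i" by linarith
  then show ?case
  proof cases
    case 1
    then have less: "\<And>s. s \<in> insert b S \<Longrightarrow> i < s" using insert(2) by force
    then have "i \<notin> insert b S" by blast
    moreover have "ordered_prod v (insert i (insert b S)) = v i \<cdot> ordered_prod v (insert b S)"
      by (rule ordered_prod_insert_min) (use insert(1) less in auto)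
    ultimately show ?thesis using ext_sign_min[of "insert b S" i] less by simp
  next
    case 2
    then show ?thesis unfolding ins
      by (simp add: ext_mult_assoc[symmetric] degree_one_square[OF v])
  next
    case 3
    have "v i \<cdot> ordered_prod v (insert b S) = (\<lambda>R. - 1 * (v b \<cdot> v i) R) \<cdot> ordered_prod v S"
      unfolding ins by (simp add: ext_mult_assoc[symmetric] degree_one_anticommute[OF v v, of i b])
    also have "\<dots> = (\<lambda>R. - 1 * (v b \<cdot> (v i \<cdot> ordered_prod v S)) R)"
      by (simp only: ext_mult_scale_left ext_mult_assoc)
    finally have step: "v i \<cdot> ordered_prod v (insert b S) =
        (\<lambda>R. - 1 * (v b \<cdot> (v i \<cdot> ordered_prod v S)) R)" .
    show ?thesis
    proof (cases "i \<in> S")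
      case True
      then show ?thesis unfolding step insert(3) by simp
    next
      case False
      have "ordered_prod v (insert b (insert i S)) = v b \<cdot> ordered_prod v (insert i S)"
        by (rule ordered_prod_insert_min) (use insert(1,2) 3 in auto)
      moreover have "ext_sign {i} (insert b S) = - ext_sign {i} S"
        using ext_sign_insert_right[OF insert(1) bS, of "{i}"] 3 by (simp add: ext_sign_def)
      ultimately show ?thesis unfolding step insert(3) using False 3
        by (simp add: ext_mult_scale_right insert_commute)
    qed
  qed
qed

text \<open>
  Ordered products of anticommuting elements obey the multiplication table of the monomials
  \<open>e\<^sub>S\<close>.  This is what makes \<open>e\<^sub>S \<mapsto> v\<^sub>S\<close> multiplicative.
\<close>

lemma ordered_prod_mult:
  assumes v: "\<And>i. v i \<in> ext_grading m 1" and S: "finite S" and T: "finite T"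
  shows "ordered_prod v S \<cdot> ordered_prod v T =
    (if S \<inter> T = {} then (\<lambda>R. ext_sign S T * ordered_prod v (S \<union> T) R) else (\<lambda>R. 0))"
  using S
proof (induct S rule: finite_induct_min)
  case empty
  have "ordered_prod v T \<in> carrier (ext_alg m)"
    using ordered_prod_grading[OF T] v by (auto simp: ext_grading_def)
  then show ?case by (simp add: ext_mult_one_left)
next
  case (insert b S)
  have bS: "b \<notin> S" using insert(2) by blast
  have "ordered_prod v (insert b S) \<cdot> ordered_prod v T =
      v b \<cdot> (ordered_prod v S \<cdot> ordered_prod v T)"
    by (simp add: ordered_prod_insert_min[OF insert(1,2)] ext_mult_assoc)
  also have "\<dots> = (if insert b S \<inter> T = {}
      then (\<lambda>R. ext_sign (insert b S) T * ordered_prod v (insert b S \<union> T) R) else (\<lambda>R. 0))"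
  proof (cases "S \<inter> T = {}")
    case False
    then show ?thesis unfolding insert(3) by auto
  next
    case True
    have "ext_sign {b} (S \<union> T) = ext_sign {b} T"
      using ext_sign_Un_right[OF insert(1) T True, of "{b}"] ext_sign_min[OF insert(2)] by simp
    moreover have "v b \<cdot> ordered_prod v (S \<union> T) = (if b \<in> S \<union> T then (\<lambda>R. 0)
        else (\<lambda>R. ext_sign {b} (S \<union> T) * ordered_prod v (insert b (S \<union> T)) R))"
      by (rule ordered_prod_gen_mult[OF v]) (use insert(1) T in simp)
    ultimately show ?thesis unfolding insert(3) using True bS
      by (auto simp: ext_mult_scale_right ext_sign_insert_left[OF insert(1) bS] mult_ac)
  qed
  finally show ?case .
qed

text \<open>
  The monomials are themselves ordered products of the generators, so a homomorphism is
  determined on them by its values on the generators.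
\<close>

lemma ext_monom_insert_min:
  assumes "finite S" "\<And>s. s \<in> S \<Longrightarrow> i < s"
  shows "ext_monom (insert i S) = ext_monom {i} \<cdot> ext_monom S"
proof
  fix R
  have iS: "i \<notin> S" using assms(2) by blast
  have "(ext_monom {i} \<cdot> ext_monom S) R =
      (\<Sum>Q\<in>Pow R. if Q = {i} then (if R - {i} = S then 1 else 0) else 0)"
    unfolding ext_mult_def ext_monom_def
    by (intro sum.cong) (auto simp: ext_sign_min[of S i] assms(2))
  also have "\<dots> = (if i \<in> R \<and> R - {i} = S then 1 else 0)"
    using assms(1) by (cases "finite R") (auto simp: sum.delta)
  also have "\<dots> = ext_monom (insert i S) R"
    using iS assms(1) by (auto simp: ext_monom_def)
  finally show "ext_monom (insert i S) R = (ext_monom {i} \<cdot> ext_monom S) R" ..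
qed

text \<open>
  For \<open>v i\<close> of degree one this is the algebra homomorphism with \<open>e\<^sub>i \<mapsto> v i\<close>.
\<close>

definition ext_hom :: "nat \<Rightarrow> (nat \<Rightarrow> nat set \<Rightarrow> complex) \<Rightarrow> (nat set \<Rightarrow> complex) \<Rightarrow> nat set \<Rightarrow> complex" where
  "ext_hom m v a = (\<lambda>R. \<Sum>S\<in>Pow {..<m}. a S * ordered_prod v S R)"

lemma ext_hom_add: "ext_hom m v (\<lambda>S. a S + b S) = (\<lambda>R. ext_hom m v a R + ext_hom m v b R)"
  by (simp add: ext_hom_def distrib_right sum.distrib)

lemma ext_hom_scale: "ext_hom m v (\<lambda>S. c * a S) = (\<lambda>R. c * ext_hom m v a R)"
  by (simp add: ext_hom_def sum_distrib_left mult.assoc)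

lemma ext_hom_monom:
  assumes "S \<subseteq> {..<m}"
  shows "ext_hom m v (ext_monom S) = ordered_prod v S"
proof
  fix R
  have "ext_hom m v (ext_monom S) R = (\<Sum>T\<in>Pow {..<m}. if T = S then ordered_prod v S R else 0)"
    unfolding ext_hom_def ext_monom_def by (intro sum.cong) auto
  with assms show "ext_hom m v (ext_monom S) R = ordered_prod v S R" by simp
qed

lemma ext_hom_one: "ext_hom m v (ext_monom {}) = ext_monom {}"
  by (simp add: ext_hom_monom)

text \<open>
  By bilinearity only products of monomials matter.  The terms with overlapping index sets,
  which are absent on the left, vanish on the right.
\<close>

lemma ext_hom_mult:
  assumes v: "\<And>i. v i \<in> ext_grading n 1"
  shows "ext_hom m v (a \<cdot> b) = ext_hom m v a \<cdot> ext_hom m v b"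
proof
  fix R
  let ?P = "Pow {..<m}" and ?V = "ordered_prod v"
  have fin: "finite S" if "S \<subseteq> {..<m}" for S using that by (rule finite_subset) simp
  have "ext_hom m v (a \<cdot> b) R =
      (\<Sum>S\<in>?P. \<Sum>T\<in>Pow S. a T * b (S - T) * (?V T \<cdot> ?V (S - T)) R)"
    unfolding ext_hom_def ext_mult_def[of a b] sum_distrib_right
  proof (intro sum.cong refl)
    fix S T assume S: "S \<in> ?P" "T \<in> Pow S"
    have "T \<union> (S - T) = S" using S by auto
    moreover have "finite T" "finite (S - T)" using S fin[of S] by (auto intro: finite_subset)
    ultimately show "ext_sign T (S - T) * a T * b (S - T) * ?V S R =
        a T * b (S - T) * (?V T \<cdot> ?V (S - T)) R"
      by (simp add: ordered_prod_mult[OF v] mult_ac)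
  qed
  also have "\<dots> = (\<Sum>(S, T)\<in>(SIGMA S:?P. Pow S). a T * b (S - T) * (?V T \<cdot> ?V (S - T)) R)"
    by (rule sum.Sigma) (auto dest: fin)
  also have "\<dots> = (\<Sum>(T, Q)\<in>(SIGMA T:?P. {Q \<in> ?P. T \<inter> Q = {}}). a T * b Q * (?V T \<cdot> ?V Q) R)"
    by (rule sum.reindex_bij_witness[of _ "\<lambda>(T, Q). (T \<union> Q, T)" "\<lambda>(S, T). (T, S - T)"]) auto
  also have "\<dots> = (\<Sum>(T, Q)\<in>?P \<times> ?P. a T * b Q * (?V T \<cdot> ?V Q) R)"
  proof (rule sum.mono_neutral_left)
    show "\<forall>p\<in>?P \<times> ?P - (SIGMA T:?P. {Q \<in> ?P. T \<inter> Q = {}}).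
        (case p of (T, Q) \<Rightarrow> a T * b Q * (?V T \<cdot> ?V Q) R) = 0"
    proof
      fix p assume p: "p \<in> ?P \<times> ?P - (SIGMA T:?P. {Q \<in> ?P. T \<inter> Q = {}})"
      obtain T Q where TQ: "p = (T, Q)" by (cases p)
      then have "finite T" "finite Q" "T \<inter> Q \<noteq> {}" using p by (auto intro: fin)
      then show "(case p of (T, Q) \<Rightarrow> a T * b Q * (?V T \<cdot> ?V Q) R) = 0"
        by (simp add: TQ ordered_prod_mult[OF v])
    qed
  qed auto
  also have "\<dots> = (\<Sum>T\<in>?P. \<Sum>Q\<in>?P. a T * b Q * (?V T \<cdot> ?V Q) R)"
    by (rule sum.cartesian_product[symmetric])
  also have "\<dots> = (ext_hom m v a \<cdot> ext_hom m v b) R"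
    unfolding ext_hom_def ext_mult_sum_left ext_mult_sum_right ext_mult_scale_left ext_mult_scale_right
    by (simp add: sum_distrib_left mult_ac)
  finally show "ext_hom m v (a \<cdot> b) R = (ext_hom m v a \<cdot> ext_hom m v b) R" .
qed

lemma ext_hom_grading:
  assumes v: "\<And>i. v i \<in> ext_grading n 1" and a: "a \<in> ext_grading m p"
  shows "ext_hom m v a \<in> ext_grading n p"
proof -
  have "ordered_prod v S \<in> ext_grading n (card S)" if "S \<subseteq> {..<m}" for S
    using that v by (intro ordered_prod_grading) (auto intro: finite_subset)
  then have *: "ordered_prod v S \<in> carrier (ext_alg n)" "card R \<noteq> card S \<Longrightarrow> ordered_prod v S R = 0"
    if "S \<subseteq> {..<m}" for S R :: "nat set" using that by (auto simp: ext_grading_def)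
  show ?thesis
    unfolding ext_grading_def ext_alg_carrier_iff ext_hom_def mem_Collect_eq
  proof (intro conjI allI impI sum.neutral ballI)
    fix S R :: "nat set" assume "\<not> R \<subseteq> {..<n}" "S \<in> Pow {..<m}"
    then show "a S * ordered_prod v S R = 0" using *(1)[of S] by (simp add: ext_alg_carrier_iff)
  next
    fix S R :: "nat set" assume "card R \<noteq> p" "S \<in> Pow {..<m}"
    then show "a S * ordered_prod v S R = 0"
      using *(2)[of S R] a by (cases "card S = p") (auto simp: ext_grading_def)
  qed
qed

section \<open>Smooth functions on open subsets of the plane\<close>

lemma pderiv_coord_eq: "(g has_derivative g') (at x) \<Longrightarrow> pderiv_coord j g x = g' (coord_vec j)"
  unfolding pderiv_coord_def by (metis frechet_derivative_at)

lemma has_derivative_frechet: "g differentiable (at x) \<Longrightarrow> (g has_derivative frechet_derivative g (at x)) (at x)"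
  by (simp add: frechet_derivative_works)

text \<open>
  The coefficients of a form are extended by zero outside \<open>U\<close>; on the open set \<open>U\<close> their
  derivatives are insensitive to this extension.
\<close>

lemma pderiv_coord_cong:
  assumes "open U" "x \<in> U" "\<And>y. y \<in> U \<Longrightarrow> f y = g y"
  shows "pderiv_coord j f x = pderiv_coord j g x"
proof -
  have "(f has_derivative D) (at x) \<longleftrightarrow> (g has_derivative D) (at x)" for D
    using has_derivative_transform_within_open[of f D x UNIV U g]
      has_derivative_transform_within_open[of g D x UNIV U f] assms by auto
  then show ?thesis by (simp add: pderiv_coord_def frechet_derivative_def)
qed

lemma pderiv_coord_const [simp]: "pderiv_coord j (\<lambda>y. c) x = 0"
  by (simp add: pderiv_coord_def)

lemma pderiv_coord_add:
  "f differentiable (at x) \<Longrightarrow> g differentiable (at x) \<Longrightarrow>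
    pderiv_coord j (\<lambda>y. f y + g y) x = pderiv_coord j f x + pderiv_coord j g x"
  by (subst pderiv_coord_eq[OF has_derivative_add[OF has_derivative_frechet has_derivative_frechet]])
     (simp_all add: pderiv_coord_def)

lemma pderiv_coord_mult:
  "f differentiable (at x) \<Longrightarrow> g differentiable (at x) \<Longrightarrow>
    pderiv_coord j (\<lambda>y. f y * g y) x = pderiv_coord j f x * g x + f x * pderiv_coord j g x"
  by (subst pderiv_coord_eq[OF has_derivative_mult[OF has_derivative_frechet has_derivative_frechet]])
     (simp_all add: pderiv_coord_def)

lemma pderiv_coord_cmult:
  "f differentiable (at x) \<Longrightarrow> pderiv_coord j (\<lambda>y. c * f y) x = c * pderiv_coord j f x"
  by (simp add: pderiv_coord_mult)

lemma pderiv_coord_sum: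
  assumes "\<And>i. i \<in> N \<Longrightarrow> f i differentiable (at x)"
  shows "pderiv_coord j (\<lambda>y. \<Sum>i\<in>N. f i y) x = (\<Sum>i\<in>N. pderiv_coord j (f i) x)"
proof -
  have "((\<lambda>y. \<Sum>i\<in>N. f i y) has_derivative (\<lambda>h. \<Sum>i\<in>N. frechet_derivative (f i) (at x) h)) (at x)"
    by (intro has_derivative_sum has_derivative_frechet assms)
  from pderiv_coord_eq[OF this] show ?thesis by (simp add: pderiv_coord_def)
qed

lemma pderiv_coord_inverse:
  assumes "f differentiable (at x)" "f x \<noteq> 0"
  shows "pderiv_coord j (\<lambda>y. inverse (f y)) x = - 1 * (pderiv_coord j f x * (inverse (f x) * inverse (f x)))"
  by (subst pderiv_coord_eq[OF Deriv.has_derivative_inverse[OF assms(2) has_derivative_frechet[OF assms(1)]]])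
     (simp add: pderiv_coord_def)

lemma C_k_on_cong:
  assumes "open U" "\<And>y. y \<in> U \<Longrightarrow> f y = g y"
  shows "C_k_on k U f \<longleftrightarrow> C_k_on k U g"
proof -
  have "C_k_on k U g" if "C_k_on k U f" "\<And>y. y \<in> U \<Longrightarrow> f y = g y" for f g
    using that
  proof (induct k arbitrary: f g)
    case 0
    then show ?case by (simp cong: continuous_on_cong)
  next
    case (Suc k)
    have "g differentiable (at x)" if x: "x \<in> U" for x
    proof -
      have "(f has_derivative frechet_derivative f (at x)) (at x)"
        using Suc.prems(1) x by (simp add: has_derivative_frechet)
      then have "(g has_derivative frechet_derivative f (at x)) (at x)"
        using has_derivative_transform_within_open[of f _ x UNIV U g] assms(1) x Suc.prems(2) by simp
      then show ?thesis unfolding differentiable_def by blast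
    qed
    moreover have "C_k_on k U (pderiv_coord j g)" if "j < 4" for j
      by (rule Suc.hyps[of "pderiv_coord j f"])
         (use Suc.prems that pderiv_coord_cong[OF assms(1), of _ f g j] in auto)
    ultimately show ?case by simp
  qed
  from this[of f g] this[of g f] assms(2) show ?thesis by auto
qed

lemma C_k_on_differentiable: "C_k_on (Suc k) U f \<Longrightarrow> x \<in> U \<Longrightarrow> f differentiable (at x)"
  by simp

lemma C_k_on_SucD: "C_k_on (Suc k) U f \<Longrightarrow> C_k_on k U f"
proof (induct k arbitrary: f)
  case 0
  then show ?case
    by (auto intro!: continuous_at_imp_continuous_on differentiable_imp_continuous_within)
next
  case (Suc k)
  have "C_k_on k U (pderiv_coord j f)" if "j < 4" for j
    by (rule Suc.hyps) (use Suc.prems that in simp)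
  with Suc.prems show ?case by simp
qed

lemma C_k_on_const: "C_k_on k U (\<lambda>x. c)"
proof (induct k arbitrary: c)
  case (Suc k)
  have "pderiv_coord j (\<lambda>x. c) = (\<lambda>x. 0)" for j by (simp add: fun_eq_iff)
  with Suc show ?case by simp
qed simp

lemma C_k_on_add:
  assumes "open U" "C_k_on k U f" "C_k_on k U g"
  shows "C_k_on k U (\<lambda>x. f x + g x)"
  using assms(2,3)
proof (induct k arbitrary: f g)
  case 0
  then show ?case by (simp add: continuous_on_add)
next
  case (Suc k)
  have "C_k_on k U (\<lambda>x. pderiv_coord j f x + pderiv_coord j g x)" if "j < 4" for j
    by (rule Suc.hyps) (use Suc.prems that in auto)
  then have "C_k_on k U (pderiv_coord j (\<lambda>x. f x + g x))" if "j < 4" for j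
    using that Suc.prems
    by (subst C_k_on_cong[OF assms(1), of _ "\<lambda>x. pderiv_coord j f x + pderiv_coord j g x"])
       (auto simp: pderiv_coord_add)
  with Suc.prems show ?case by simp
qed

lemma C_k_on_mult:
  assumes "open U" "C_k_on k U f" "C_k_on k U g"
  shows "C_k_on k U (\<lambda>x. f x * g x)"
  using assms(2,3)
proof (induct k arbitrary: f g)
  case 0
  then show ?case by (simp add: continuous_on_mult)
next
  case (Suc k)
  have "C_k_on k U f" "C_k_on k U g" using Suc.prems by (blast intro: C_k_on_SucD)+
  then have "C_k_on k U (\<lambda>x. pderiv_coord j f x * g x + f x * pderiv_coord j g x)" if "j < 4" for j
    by (intro C_k_on_add[OF assms(1)] Suc.hyps) (use Suc.prems that in auto)
  then have "C_k_on k U (pderiv_coord j (\<lambda>x. f x * g x))" if "j < 4" for j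
    using that Suc.prems
    by (subst C_k_on_cong[OF assms(1), of _ "\<lambda>x. pderiv_coord j f x * g x + f x * pderiv_coord j g x"])
       (auto simp: pderiv_coord_mult)
  with Suc.prems show ?case by simp
qed

lemma C_k_on_inverse:
  assumes "open U" "C_k_on k U f" "\<And>x. x \<in> U \<Longrightarrow> f x \<noteq> 0"
  shows "C_k_on k U (\<lambda>x. inverse (f x))"
  using assms(2)
proof (induct k)
  case 0
  then show ?case using assms(3) by (simp add: continuous_on_inverse)
next
  case (Suc k)
  have "C_k_on k U f" using Suc.prems by (rule C_k_on_SucD)
  then have "C_k_on k U (\<lambda>x. - 1 * (pderiv_coord j f x * (inverse (f x) * inverse (f x))))" if "j < 4" for j
    by (intro C_k_on_mult[OF assms(1)] Suc.hyps C_k_on_const) (use Suc.prems that in auto)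
  then have "C_k_on k U (pderiv_coord j (\<lambda>x. inverse (f x)))" if "j < 4" for j
    using that Suc.prems assms(3)
    by (subst C_k_on_cong[OF assms(1), of _ "\<lambda>x. - 1 * (pderiv_coord j f x * (inverse (f x) * inverse (f x)))"])
       (auto simp: pderiv_coord_inverse)
  with Suc.prems assms(3) show ?case by simp
qed

lemma C_infinity_on_cong:
  "open U \<Longrightarrow> (\<And>y. y \<in> U \<Longrightarrow> f y = g y) \<Longrightarrow> C_infinity_on U f \<longleftrightarrow> C_infinity_on U g"
  unfolding C_infinity_on_def using C_k_on_cong by blast

lemma C_infinity_on_const [simp]: "C_infinity_on U (\<lambda>x. c)"
  by (simp add: C_infinity_on_def C_k_on_const)

lemma C_infinity_on_add:
  "open U \<Longrightarrow> C_infinity_on U f \<Longrightarrow> C_infinity_on U g \<Longrightarrow> C_infinity_on U (\<lambda>x. f x + g x)"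
  by (simp add: C_infinity_on_def C_k_on_add)

lemma C_infinity_on_mult:
  "open U \<Longrightarrow> C_infinity_on U f \<Longrightarrow> C_infinity_on U g \<Longrightarrow> C_infinity_on U (\<lambda>x. f x * g x)"
  by (simp add: C_infinity_on_def C_k_on_mult)

lemma C_infinity_on_inverse:
  "open U \<Longrightarrow> C_infinity_on U f \<Longrightarrow> (\<And>x. x \<in> U \<Longrightarrow> f x \<noteq> 0) \<Longrightarrow> C_infinity_on U (\<lambda>x. inverse (f x))"
  by (simp add: C_infinity_on_def C_k_on_inverse)

lemma C_infinity_on_sum:
  assumes "open U" "\<And>i. i \<in> N \<Longrightarrow> C_infinity_on U (f i)"
  shows "C_infinity_on U (\<lambda>x. \<Sum>i\<in>N. f i x)"
  using assms(2)
  by (induct N rule: infinite_finite_induct) (simp_all add: C_infinity_on_add assms(1))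

lemma C_infinity_on_pderiv: "j < 4 \<Longrightarrow> C_infinity_on U f \<Longrightarrow> C_infinity_on U (pderiv_coord j f)"
  unfolding C_infinity_on_def using C_k_on.simps(2) by blast

lemma C_infinity_on_differentiable: "C_infinity_on U f \<Longrightarrow> x \<in> U \<Longrightarrow> f differentiable (at x)"
  unfolding C_infinity_on_def using C_k_on_differentiable by blast

lemma C_infinity_on_continuous: "C_infinity_on U f \<Longrightarrow> continuous_on U f"
  unfolding C_infinity_on_def using C_k_on.simps(1) by blast

lemma C_infinity_on_linear:
  assumes "bounded_linear l"
  shows "C_infinity_on U l"
proof -
  have d: "(l has_derivative l) (at x)" for x by (rule bounded_linear_imp_has_derivative[OF assms])
  have "C_k_on k U l" for k
  proof (cases k)
    case 0
    then show ?thesis using linear_continuous_on[OF assms] by simp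
  next
    case (Suc n)
    have "pderiv_coord j l = (\<lambda>x. l (coord_vec j))" for j
      using pderiv_coord_eq[OF d] by (simp add: fun_eq_iff)
    then show ?thesis using d by (auto simp: Suc C_k_on_const differentiable_def)
  qed
  then show ?thesis by (simp add: C_infinity_on_def)
qed

section \<open>Symmetry of second derivatives\<close>

text \<open>
  The mean value theorem along \<open>u\<close>, followed by the mean value theorem along \<open>v\<close>.
\<close>

lemma second_difference_mean_value:
  fixes h :: "'a::real_normed_vector \<Rightarrow> real"
  assumes sub: "ball x d \<subseteq> U" and s: "s > 0" "s * (norm u + norm v) < d"
    and h: "\<And>y. y \<in> U \<Longrightarrow> (h has_derivative h' y) (at y)"
    and A: "\<And>y. y \<in> U \<Longrightarrow> ((\<lambda>y. h' y u) has_derivative A y) (at y)"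
  shows "\<exists>y\<in>ball x d. h (x + s *\<^sub>R u + s *\<^sub>R v) - h (x + s *\<^sub>R u) - h (x + s *\<^sub>R v) + h x = s * s * A y v"
proof -
  have near: "x + \<sigma> *\<^sub>R u + \<tau> *\<^sub>R v \<in> ball x d" if "0 \<le> \<sigma>" "\<sigma> \<le> s" "0 \<le> \<tau>" "\<tau> \<le> s" for \<sigma> \<tau>
  proof -
    have "norm (\<sigma> *\<^sub>R u + \<tau> *\<^sub>R v) \<le> \<sigma> * norm u + \<tau> * norm v"
      using norm_triangle_ineq[of "\<sigma> *\<^sub>R u" "\<tau> *\<^sub>R v"] that by simp
    also have "\<dots> \<le> s * norm u + s * norm v" using that by (intro add_mono mult_right_mono) auto
    also have "\<dots> < d" using s(2) by (simp add: distrib_left)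
    finally have "norm (\<sigma> *\<^sub>R u + \<tau> *\<^sub>R v) < d" .
    moreover have "dist x (x + \<sigma> *\<^sub>R u + \<tau> *\<^sub>R v) = norm (\<sigma> *\<^sub>R u + \<tau> *\<^sub>R v)"
      using norm_minus_cancel[of "\<sigma> *\<^sub>R u + \<tau> *\<^sub>R v"] by (simp add: dist_norm)
    ultimately show ?thesis by simp
  qed
  have in_U: "x + \<sigma> *\<^sub>R u + \<tau> *\<^sub>R v \<in> U" if "0 \<le> \<sigma>" "\<sigma> \<le> s" "0 \<le> \<tau>" "\<tau> \<le> s" for \<sigma> \<tau>
    using near[OF that] sub by blast
  \<comment> \<open>The term \<open>0 *\<^sub>R v\<close> is kept so that the two summands are instances of the same function.\<close>
  define \<phi> where "\<phi> \<sigma> = h (x + \<sigma> *\<^sub>R u + s *\<^sub>R v) - h (x + \<sigma> *\<^sub>R u + 0 *\<^sub>R v)" for \<sigma>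
  have lin: "h' y (t *\<^sub>R w) = t * h' y w" "A y (t *\<^sub>R w) = t * A y w" if "y \<in> U" for y t w
    using linear_scale[OF has_derivative_linear[OF h[OF that]]]
      linear_scale[OF has_derivative_linear[OF A[OF that]]] by simp_all
  have "(\<phi> has_derivative
      (\<lambda>t. t * (h' (x + \<sigma> *\<^sub>R u + s *\<^sub>R v) u - h' (x + \<sigma> *\<^sub>R u + 0 *\<^sub>R v) u))) (at \<sigma> within {0..s})"
    if \<sigma>: "0 \<le> \<sigma>" "\<sigma> \<le> s" for \<sigma>
  proof -
    have "((\<lambda>\<sigma>. h (x + \<sigma> *\<^sub>R u + \<tau> *\<^sub>R v)) has_derivative
        (\<lambda>t. h' (x + \<sigma> *\<^sub>R u + \<tau> *\<^sub>R v) (t *\<^sub>R u))) (at \<sigma> within {0..s})"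
      if "0 \<le> \<tau>" "\<tau> \<le> s" for \<tau>
      by (rule has_derivative_compose[where g = h and f = "\<lambda>\<sigma>. x + \<sigma> *\<^sub>R u + \<tau> *\<^sub>R v",
            OF _ h[OF in_U[OF \<sigma> that]]])
         (auto intro!: derivative_eq_intros)
    from has_derivative_diff[OF this[of s] this[of 0]] show ?thesis
      unfolding \<phi>_def using \<sigma> s(1) in_U[of \<sigma> s] in_U[of \<sigma> 0] by (simp add: lin right_diff_distrib)
  qed
  from mvt_simple[OF s(1) this] obtain \<sigma> where \<sigma>: "0 < \<sigma>" "\<sigma> < s"
    and 1: "\<phi> s - \<phi> 0 = s * (h' (x + \<sigma> *\<^sub>R u + s *\<^sub>R v) u - h' (x + \<sigma> *\<^sub>R u + 0 *\<^sub>R v) u)"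
    by auto
  have "((\<lambda>\<tau>. h' (x + \<sigma> *\<^sub>R u + \<tau> *\<^sub>R v) u) has_derivative
      (\<lambda>t. t * A (x + \<sigma> *\<^sub>R u + \<tau> *\<^sub>R v) v)) (at \<tau> within {0..s})"
    if \<tau>: "0 \<le> \<tau>" "\<tau> \<le> s" for \<tau>
  proof -
    have y: "x + \<sigma> *\<^sub>R u + \<tau> *\<^sub>R v \<in> U" using in_U \<sigma> \<tau> by simp
    have "((\<lambda>\<tau>. h' (x + \<sigma> *\<^sub>R u + \<tau> *\<^sub>R v) u) has_derivative
        (\<lambda>t. A (x + \<sigma> *\<^sub>R u + \<tau> *\<^sub>R v) (t *\<^sub>R v))) (at \<tau> within {0..s})"
      by (rule has_derivative_compose[where g = "\<lambda>y. h' y u" and f = "\<lambda>\<tau>. x + \<sigma> *\<^sub>R u + \<tau> *\<^sub>R v",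
            OF _ A[OF y]]) (auto intro!: derivative_eq_intros)
    then show ?thesis by (simp add: lin(2)[OF y])
  qed
  from mvt_simple[OF s(1) this] obtain \<tau> where \<tau>: "0 < \<tau>" "\<tau> < s"
    and 2: "h' (x + \<sigma> *\<^sub>R u + s *\<^sub>R v) u - h' (x + \<sigma> *\<^sub>R u + 0 *\<^sub>R v) u
      = s * A (x + \<sigma> *\<^sub>R u + \<tau> *\<^sub>R v) v"
    by auto
  have "\<phi> s - \<phi> 0 = h (x + s *\<^sub>R u + s *\<^sub>R v) - h (x + s *\<^sub>R u) - h (x + s *\<^sub>R v) + h x"
    by (simp add: \<phi>_def)
  then show ?thesis using 1 2 near[of \<sigma> \<tau>] \<sigma> \<tau>
    by (intro bexI[of _ "x + \<sigma> *\<^sub>R u + \<tau> *\<^sub>R v"]) (simp_all add: mult.assoc)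
qed

text \<open>
  The second difference is symmetric in \<open>u\<close> and \<open>v\<close>, so it equals \<open>s\<^sup>2\<close> times a value near \<open>x\<close>
  of either mixed derivative.  By continuity at \<open>x\<close> the two derivatives agree there.
\<close>

lemma mixed_derivatives_commute:
  fixes h :: "'a::real_normed_vector \<Rightarrow> real"
  assumes "open U" "x \<in> U"
    and h: "\<And>y. y \<in> U \<Longrightarrow> (h has_derivative h' y) (at y)"
    and A: "\<And>y. y \<in> U \<Longrightarrow> ((\<lambda>y. h' y u) has_derivative A y) (at y)"
    and B: "\<And>y. y \<in> U \<Longrightarrow> ((\<lambda>y. h' y v) has_derivative B y) (at y)"
    and cont: "isCont (\<lambda>y. A y v) x" "isCont (\<lambda>y. B y u) x"
  shows "A x v = B x u"
proof (rule ccontr)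
  assume "A x v \<noteq> B x u"
  then have e: "\<bar>A x v - B x u\<bar> / 2 > 0" (is "?e > 0") by simp
  obtain d1 where d1: "d1 > 0" "\<And>y. dist y x < d1 \<Longrightarrow> dist (A y v) (A x v) < ?e"
    using cont(1)[unfolded continuous_at_eps_delta, rule_format, OF e] by auto
  obtain d2 where d2: "d2 > 0" "\<And>y. dist y x < d2 \<Longrightarrow> dist (B y u) (B x u) < ?e"
    using cont(2)[unfolded continuous_at_eps_delta, rule_format, OF e] by auto
  obtain d3 where d3: "d3 > 0" "ball x d3 \<subseteq> U" using assms(1,2) by (meson open_contains_ball)
  define d where "d = min d3 (min d1 d2)"
  have d: "d > 0" "ball x d \<subseteq> U" using d1 d2 d3 by (auto simp: d_def)
  \<comment> \<open>A step so short that the parallelogram spanned by \<open>s u\<close> and \<open>s v\<close> at \<open>x\<close> stays in the ball of radius \<open>d\<close>.\<close>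
  define s where "s = d / (2 * (norm u + norm v + 1))"
  have pos: "norm u + norm v + 1 > 0" by (simp add: add_nonneg_pos)
  then have s: "s > 0" using d(1) by (simp add: s_def)
  have "s * (norm u + norm v) \<le> s * (norm u + norm v + 1)" using s by simp
  also have "\<dots> = d / 2" using pos by (simp add: s_def field_simps)
  also have "\<dots> < d" using d(1) by simp
  finally have sd: "s * (norm u + norm v) < d" .
  obtain y where y: "y \<in> ball x d"
    "h (x + s *\<^sub>R u + s *\<^sub>R v) - h (x + s *\<^sub>R u) - h (x + s *\<^sub>R v) + h x = s * s * A y v"
    using second_difference_mean_value[OF d(2) s sd h A] by blast
  obtain z where z: "z \<in> ball x d"
    "h (x + s *\<^sub>R v + s *\<^sub>R u) - h (x + s *\<^sub>R v) - h (x + s *\<^sub>R u) + h x = s * s * B z u"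
    using second_difference_mean_value[OF d(2) s, of v u h h' B] sd h B by (auto simp: add.commute)
  have "x + s *\<^sub>R v + s *\<^sub>R u = x + s *\<^sub>R u + s *\<^sub>R v" by simp
  with y(2) z(2) have "s * s * A y v = s * s * B z u" by (simp only:)
  then have "A y v = B z u" using s by simp
  moreover have "\<bar>A y v - A x v\<bar> < ?e" "\<bar>B z u - B x u\<bar> < ?e"
    using d1(2)[of y] d2(2)[of z] y(1) z(1) by (auto simp: d_def dist_commute[of x] dist_real_def)
  ultimately show False by (simp add: abs_if split: if_splits)
qed

text \<open>
  The mean value theorem is about real functions, hence the real and the imaginary part are
  treated separately.
\<close>

lemma pderiv_coord_commute:
  assumes U: "open U" "x \<in> U" and g: "C_infinity_on U g" and ij: "i < 4" "j < 4"
  shows "pderiv_coord i (pderiv_coord j g) x = pderiv_coord j (pderiv_coord i g) x"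
proof -
  let ?D = "\<lambda>g y. frechet_derivative g (at y)"
  have smooth: "C_infinity_on U (pderiv_coord k g)" "C_infinity_on U (pderiv_coord l (pderiv_coord k g))"
    if "k < 4" "l < 4" for k l
    using that g by (auto intro: C_infinity_on_pderiv)
  have part: "p (pderiv_coord i (pderiv_coord j g) x) = p (pderiv_coord j (pderiv_coord i g) x)"
    if p: "bounded_linear p" for p :: "complex \<Rightarrow> real"
  proof -
    have d: "((\<lambda>y. p (f y)) has_derivative (\<lambda>t. p (?D f y t))) (at y)"
      if "C_infinity_on U f" "y \<in> U" for f y
      by (rule bounded_linear.has_derivative[OF p])
         (rule has_derivative_frechet[OF C_infinity_on_differentiable[OF that]])
    have c: "isCont (\<lambda>y. p (pderiv_coord l (pderiv_coord k g) y)) x" if "k < 4" "l < 4" for k l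
      using C_infinity_on_continuous[OF smooth(2)[OF that]] U
      by (intro bounded_linear.isCont[OF p]) (simp add: continuous_on_eq_continuous_at)
    show ?thesis
      using mixed_derivatives_commute[OF U, of "\<lambda>y. p (g y)" "\<lambda>y t. p (?D g y t)" "coord_vec j"
          "\<lambda>y t. p (?D (pderiv_coord j g) y t)" "coord_vec i" "\<lambda>y t. p (?D (pderiv_coord i g) y t)"]
        d[OF g] d[OF smooth(1), OF ij(2) ij(2)] d[OF smooth(1), OF ij(1) ij(1)]
        c[OF ij(1) ij(2)] c[OF ij(2) ij(1)]
      by (simp add: pderiv_coord_def)
  qed
  show ?thesis
    using part[OF bounded_linear_Re] part[OF bounded_linear_Im] by (simp add: complex_eq_iff)
qed

section \<open>The exterior derivative\<close>

lemma forms_vanish: "\<omega> \<in> forms U \<Longrightarrow> x \<notin> U \<or> \<not> S \<subseteq> {..<4} \<Longrightarrow> \<omega> x S = 0"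
  unfolding forms_def by blast

lemma forms_smooth:
  assumes "\<omega> \<in> forms U"
  shows "C_infinity_on U (\<lambda>x. \<omega> x S)"
proof (cases "S \<subseteq> {..<4}")
  case False
  then have "(\<lambda>x. \<omega> x S) = (\<lambda>x. 0)" by (intro ext forms_vanish[OF assms]) simp
  then show ?thesis by simp
qed (use assms in \<open>simp add: forms_def\<close>)

lemma forms_outside: "\<omega> \<in> forms U \<Longrightarrow> x \<notin> U \<Longrightarrow> \<omega> x = (\<lambda>S. 0)"
  using forms_vanish by blast

lemma forms_carrier: "\<omega> \<in> forms U \<Longrightarrow> \<omega> x \<in> carrier (ext_alg 4)"
  unfolding ext_alg_carrier_iff using forms_vanish by blast

lemma forms_differentiable: "\<omega> \<in> forms U \<Longrightarrow> x \<in> U \<Longrightarrow> (\<lambda>y. \<omega> y S) differentiable (at x)"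
  by (rule C_infinity_on_differentiable[OF forms_smooth])

lemma formsI:
  assumes "\<And>x. x \<notin> U \<Longrightarrow> \<omega> x = (\<lambda>S. 0)" "\<And>x. x \<in> U \<Longrightarrow> \<omega> x \<in> carrier (ext_alg 4)"
    and "\<And>S. S \<subseteq> {..<4} \<Longrightarrow> C_infinity_on U (\<lambda>x. \<omega> x S)"
  shows "\<omega> \<in> forms U"
  unfolding forms_def mem_Collect_eq
proof (intro conjI allI impI)
  fix x and S :: "nat set" assume "x \<notin> U \<or> \<not> S \<subseteq> {..<4}"
  then show "\<omega> x S = 0" using assms(1,2)[of x] by (cases "x \<in> U") (auto simp: ext_alg_carrier_iff)
qed (use assms(3) in blast)

lemma forms_zero: "(\<lambda>x S. 0) \<in> forms U"
  by (simp add: forms_def)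

lemma forms_add: "open U \<Longrightarrow> \<alpha> \<in> forms U \<Longrightarrow> \<beta> \<in> forms U \<Longrightarrow> (\<lambda>x S. \<alpha> x S + \<beta> x S) \<in> forms U"
  by (simp add: forms_def C_infinity_on_add)

lemma forms_scale: "open U \<Longrightarrow> \<alpha> \<in> forms U \<Longrightarrow> (\<lambda>x S. c S * \<alpha> x S) \<in> forms U"
  by (simp add: forms_def C_infinity_on_mult)

lemma forms_mult:
  assumes "open U" "\<alpha> \<in> forms U" "\<beta> \<in> forms U"
  shows "(\<lambda>x. \<alpha> x \<cdot> \<beta> x) \<in> forms U"
proof (rule formsI)
  fix S show "C_infinity_on U (\<lambda>x. (\<alpha> x \<cdot> \<beta> x) S)"
    unfolding ext_mult_def
    by (intro C_infinity_on_sum C_infinity_on_mult C_infinity_on_const assms forms_smooth[OF assms(2)]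
          forms_smooth[OF assms(3)])
next
  fix x
  show "x \<notin> U \<Longrightarrow> \<alpha> x \<cdot> \<beta> x = (\<lambda>S. 0)" using assms(2) by (simp add: forms_outside)
  show "\<alpha> x \<cdot> \<beta> x \<in> carrier (ext_alg 4)" using assms by (intro ext_mult_closed forms_carrier)
qed

text \<open>
  Differentiation of all coefficients with respect to one coordinate.  In terms of these
  operators \<open>d = (\<Sum>j<4. dx\<^sub>j \<and> \<partial>\<^sub>j)\<close>, so that the sign rules for \<open>d\<close> reduce to those of the
  exterior algebra.
\<close>

definition coeff_deriv :: "nat \<Rightarrow> dform \<Rightarrow> dform" where
  "coeff_deriv j \<omega> x S = pderiv_coord j (\<lambda>y. \<omega> y S) x"

lemma coeff_deriv_mult:
  assumes "\<And>S. (\<lambda>y. \<alpha> y S) differentiable (at x)" "\<And>S. (\<lambda>y. \<beta> y S) differentiable (at x)"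
  shows "coeff_deriv j (\<lambda>y. \<alpha> y \<cdot> \<beta> y) x =
    (\<lambda>S. (coeff_deriv j \<alpha> x \<cdot> \<beta> x) S + (\<alpha> x \<cdot> coeff_deriv j \<beta> x) S)"
proof
  fix S
  have "pderiv_coord j (\<lambda>y. \<Sum>T\<in>Pow S. ext_sign T (S - T) * \<alpha> y T * \<beta> y (S - T)) x =
      (\<Sum>T\<in>Pow S. pderiv_coord j (\<lambda>y. ext_sign T (S - T) * \<alpha> y T * \<beta> y (S - T)) x)"
    by (rule pderiv_coord_sum) (intro differentiable_mult differentiable_const assms)
  also have "\<dots> = (\<Sum>T\<in>Pow S. ext_sign T (S - T) * coeff_deriv j \<alpha> x T * \<beta> x (S - T) +
      ext_sign T (S - T) * \<alpha> x T * coeff_deriv j \<beta> x (S - T))"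
    by (intro sum.cong refl)
       (simp add: pderiv_coord_mult pderiv_coord_cmult differentiable_mult assms coeff_deriv_def)
  finally show "coeff_deriv j (\<lambda>y. \<alpha> y \<cdot> \<beta> y) x S =
      (coeff_deriv j \<alpha> x \<cdot> \<beta> x) S + (\<alpha> x \<cdot> coeff_deriv j \<beta> x) S"
    by (simp add: coeff_deriv_def[of j "\<lambda>y. \<alpha> y \<cdot> \<beta> y"] ext_mult_def sum.distrib)
qed

lemma ext_monom_singleton_mult:
  "(ext_monom {j} \<cdot> b) S = (if finite S \<and> j \<in> S then ext_sign {j} (S - {j}) * b (S - {j}) else 0)"
proof -
  have "(ext_monom {j} \<cdot> b) S =
      (\<Sum>T\<in>Pow S. if T = {j} then ext_sign {j} (S - {j}) * b (S - {j}) else 0)"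
    unfolding ext_mult_def ext_monom_def by (intro sum.cong) auto
  then show ?thesis by (cases "finite S") (auto simp: sum.delta)
qed

text \<open>
  On \<open>dx\<^sub>j \<and> b\<close> the sign \<open>ext_sign {j} (S - {j})\<close> of the definition is the one of the exterior
  product.
\<close>

lemma ext_deriv_eq_sum:
  assumes "\<omega> \<in> forms U" "x \<in> U"
  shows "ext_deriv U \<omega> x = (\<lambda>S. \<Sum>j<4. (ext_monom {j} \<cdot> coeff_deriv j \<omega> x) S)"
proof
  fix S
  show "ext_deriv U \<omega> x S = (\<Sum>j<4. (ext_monom {j} \<cdot> coeff_deriv j \<omega> x) S)"
  proof (cases "S \<subseteq> {..<4}")
    case True
    then have "finite S" by (rule finite_subset) simp
    have "(\<Sum>j<4. (ext_monom {j} \<cdot> coeff_deriv j \<omega> x) S) =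
        (\<Sum>j\<in>S. ext_sign {j} (S - {j}) * coeff_deriv j \<omega> x (S - {j}))"
      using True \<open>finite S\<close>
      by (intro sum.mono_neutral_cong_right) (auto simp: ext_monom_singleton_mult)
    then show ?thesis using True assms(2) by (simp add: ext_deriv_def coeff_deriv_def)
  next
    case False
    have "coeff_deriv j \<omega> x (S - {j}) = 0" if "j < 4" for j
    proof -
      have "\<not> S - {j} \<subseteq> {..<4}" using False that by auto
      then have "(\<lambda>y. \<omega> y (S - {j})) = (\<lambda>y. 0)" by (intro ext forms_vanish[OF assms(1)]) simp
      then show ?thesis by (simp add: coeff_deriv_def)
    qed
    then have "(\<Sum>j<4. (ext_monom {j} \<cdot> coeff_deriv j \<omega> x) S) = 0"
      by (intro sum.neutral) (simp add: ext_monom_singleton_mult)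
    then show ?thesis using False by (simp add: ext_deriv_def)
  qed
qed

lemma ext_deriv_outside: "x \<notin> U \<Longrightarrow> ext_deriv U \<omega> x = (\<lambda>S. 0)"
  by (simp add: ext_deriv_def fun_eq_iff)

lemma ext_deriv_forms:
  assumes "open U" "\<omega> \<in> forms U"
  shows "ext_deriv U \<omega> \<in> forms U"
proof (rule formsI)
  fix S :: "nat set" assume S: "S \<subseteq> {..<4}"
  have "C_infinity_on U (\<lambda>x. \<Sum>j\<in>S. ext_sign {j} (S - {j}) * pderiv_coord j (\<lambda>y. \<omega> y (S - {j})) x)"
    by (intro C_infinity_on_sum C_infinity_on_mult C_infinity_on_const C_infinity_on_pderiv assms(1)
          forms_smooth[OF assms(2)]) (use S in auto)
  then show "C_infinity_on U (\<lambda>x. ext_deriv U \<omega> x S)"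
    by (rule C_infinity_on_cong[OF assms(1), THEN iffD1, rotated]) (use S in \<open>simp add: ext_deriv_def\<close>)
next
  fix x
  show "x \<notin> U \<Longrightarrow> ext_deriv U \<omega> x = (\<lambda>S. 0)" by (rule ext_deriv_outside)
  show "ext_deriv U \<omega> x \<in> carrier (ext_alg 4)" by (simp add: ext_alg_carrier_iff ext_deriv_def)
qed

lemma ext_deriv_add:
  assumes "\<alpha> \<in> forms U" "\<beta> \<in> forms U"
  shows "ext_deriv U (\<lambda>x S. \<alpha> x S + \<beta> x S) = (\<lambda>x S. ext_deriv U \<alpha> x S + ext_deriv U \<beta> x S)"
  by (intro ext)
     (simp add: ext_deriv_def pderiv_coord_add forms_differentiable[OF assms(1)]
        forms_differentiable[OF assms(2)] distrib_left sum.distrib)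

lemma ext_deriv_scale:
  assumes "\<alpha> \<in> forms U"
  shows "ext_deriv U (\<lambda>x S. c * \<alpha> x S) = (\<lambda>x S. c * ext_deriv U \<alpha> x S)"
  by (intro ext)
     (simp add: ext_deriv_def pderiv_coord_cmult forms_differentiable[OF assms] sum_distrib_left mult_ac)

lemma ext_deriv_grade_invol:
  assumes "\<alpha> \<in> forms U"
  shows "ext_deriv U (\<lambda>x. grade_invol (\<alpha> x)) = (\<lambda>x S. - grade_invol (ext_deriv U \<alpha> x) S)"
proof (intro ext)
  fix x S
  show "ext_deriv U (\<lambda>x. grade_invol (\<alpha> x)) x S = - grade_invol (ext_deriv U \<alpha> x) S"
  proof (cases "x \<in> U \<and> S \<subseteq> {..<4}")
    case True
    then have "finite S" by (meson finite_lessThan finite_subset)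
    have "ext_deriv U (\<lambda>x. grade_invol (\<alpha> x)) x S = (\<Sum>j\<in>S. - ((- 1) ^ card S) *
        (ext_sign {j} (S - {j}) * pderiv_coord j (\<lambda>y. \<alpha> y (S - {j})) x))"
      unfolding ext_deriv_def using True
    proof (simp, intro sum.cong refl)
      fix j assume j: "j \<in> S"
      then have "card S = Suc (card (S - {j}))" using card.remove[OF \<open>finite S\<close> j] by simp
      then have c: "(- 1 :: complex) ^ card S = - ((- 1) ^ card (S - {j}))" by simp
      show "ext_sign {j} (S - {j}) * pderiv_coord j (\<lambda>y. grade_invol (\<alpha> y) (S - {j})) x =
          - ((- 1) ^ card S * (ext_sign {j} (S - {j}) * pderiv_coord j (\<lambda>y. \<alpha> y (S - {j})) x))"
        unfolding c grade_invol_def using True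
        by (simp add: pderiv_coord_cmult forms_differentiable[OF assms])
    qed
    also have "\<dots> = - grade_invol (ext_deriv U \<alpha> x) S"
      using True by (simp add: grade_invol_def ext_deriv_def sum_distrib_left sum_negf)
    finally show ?thesis .
  next
    case False
    then show ?thesis by (auto simp: ext_deriv_def grade_invol_def)
  qed
qed

lemma gen_degree_one: "j < m \<Longrightarrow> ext_monom {j} \<in> ext_grading m 1"
  using ext_monom_grading[of "{j}" m] by simp

text \<open>
  The Leibniz rule: \<open>\<partial>\<^sub>j\<close> is a derivation, and \<open>dx\<^sub>j\<close> passes \<open>\<alpha>\<close> at the cost of the grade
  involution.
\<close>

lemma ext_deriv_mult:
  assumes "open U" "\<alpha> \<in> forms U" "\<beta> \<in> forms U"
  shows "ext_deriv U (\<lambda>x. \<alpha> x \<cdot> \<beta> x) =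
    (\<lambda>x S. (ext_deriv U \<alpha> x \<cdot> \<beta> x) S + (grade_invol (\<alpha> x) \<cdot> ext_deriv U \<beta> x) S)"
proof (rule ext)
  fix x
  show "ext_deriv U (\<lambda>x. \<alpha> x \<cdot> \<beta> x) x =
      (\<lambda>S. (ext_deriv U \<alpha> x \<cdot> \<beta> x) S + (grade_invol (\<alpha> x) \<cdot> ext_deriv U \<beta> x) S)"
  proof (cases "x \<in> U")
    case False
    then show ?thesis by (simp add: ext_deriv_outside)
  next
    case True
    let ?e = "\<lambda>j. ext_monom {j}"
    have swap: "?e j \<cdot> (\<alpha> x \<cdot> b) = grade_invol (\<alpha> x) \<cdot> (?e j \<cdot> b)" if "j < 4" for j b
      using degree_one_swap[OF gen_degree_one[OF that], of "\<alpha> x"] by (simp add: ext_mult_assoc[symmetric])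
    have "ext_deriv U (\<lambda>x. \<alpha> x \<cdot> \<beta> x) x =
        (\<lambda>S. \<Sum>j<4. (?e j \<cdot> coeff_deriv j (\<lambda>x. \<alpha> x \<cdot> \<beta> x) x) S)"
      by (rule ext_deriv_eq_sum[OF forms_mult[OF assms] True])
    also have "\<dots> = (\<lambda>S. \<Sum>j<4. (?e j \<cdot> coeff_deriv j \<alpha> x \<cdot> \<beta> x) S +
        (grade_invol (\<alpha> x) \<cdot> (?e j \<cdot> coeff_deriv j \<beta> x)) S)"
      by (intro ext sum.cong refl)
         (simp add: coeff_deriv_mult forms_differentiable[OF assms(2) True]
           forms_differentiable[OF assms(3) True] ext_mult_add_right swap ext_mult_assoc)
    also have "\<dots> = (\<lambda>S. (ext_deriv U \<alpha> x \<cdot> \<beta> x) S + (grade_invol (\<alpha> x) \<cdot> ext_deriv U \<beta> x) S)"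
      by (simp add: ext_deriv_eq_sum[OF assms(2) True] ext_deriv_eq_sum[OF assms(3) True]
          ext_mult_sum_left ext_mult_sum_right sum.distrib)
    finally show ?thesis .
  qed
qed

text \<open>
  \<open>d \<circ> d\<close> is the sum of all \<open>dx\<^sub>i \<and> dx\<^sub>j \<and> \<partial>\<^sub>i \<partial>\<^sub>j \<omega>\<close>, which is antisymmetric under exchanging \<open>i\<close>
  and \<open>j\<close> in the first two factors and symmetric in the derivatives.
\<close>

lemma ext_deriv_ext_deriv:
  assumes U: "open U" and \<omega>: "\<omega> \<in> forms U"
  shows "ext_deriv U (ext_deriv U \<omega>) = (\<lambda>x S. 0)"
proof (rule ext)
  fix x
  show "ext_deriv U (ext_deriv U \<omega>) x = (\<lambda>S. 0)"
  proof (cases "x \<in> U")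
    case False
    then show ?thesis by (simp add: ext_deriv_outside)
  next
    case True
    let ?e = "\<lambda>j. ext_monom {j}"
    define H where "H i j = coeff_deriv i (coeff_deriv j \<omega>) x" for i j
    have H_sym: "H i j = H j i" if "i < 4" "j < 4" for i j
      unfolding H_def coeff_deriv_def using pderiv_coord_commute[OF U True forms_smooth[OF \<omega>] that]
      by (simp add: coeff_deriv_def[abs_def])
    have smooth: "(\<lambda>y. coeff_deriv j \<omega> y S) differentiable (at x)" if "j < 4" for j S
      using C_infinity_on_differentiable[OF C_infinity_on_pderiv[OF that forms_smooth[OF \<omega>]] True]
      by (simp add: coeff_deriv_def[abs_def])
    have dd: "coeff_deriv i (ext_deriv U \<omega>) x = (\<lambda>S. \<Sum>j<4. (?e j \<cdot> H i j) S)" for i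
    proof
      fix S
      have d: "(\<lambda>y. (?e j \<cdot> coeff_deriv j \<omega> y) S) differentiable (at x)" if "j < 4" for j
        by (cases "finite S \<and> j \<in> S")
           (auto simp: ext_monom_singleton_mult intro!: differentiable_mult smooth that)
      have "coeff_deriv i (ext_deriv U \<omega>) x S =
          pderiv_coord i (\<lambda>y. \<Sum>j<4. (?e j \<cdot> coeff_deriv j \<omega> y) S) x"
        unfolding coeff_deriv_def[of i "ext_deriv U \<omega>"]
        by (rule pderiv_coord_cong[OF U True]) (simp add: ext_deriv_eq_sum[OF \<omega>])
      also have "\<dots> = (\<Sum>j<4. coeff_deriv i (\<lambda>y. ?e j \<cdot> coeff_deriv j \<omega> y) x S)"
        unfolding coeff_deriv_def[of i] by (rule pderiv_coord_sum) (use d in auto)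
      also have "\<dots> = (\<Sum>j<4. (?e j \<cdot> H i j) S)"
      proof (rule sum.cong[OF refl])
        fix j :: nat assume "j \<in> {..<4}"
        then have "coeff_deriv i (\<lambda>y. ?e j \<cdot> coeff_deriv j \<omega> y) x =
            (\<lambda>S. (coeff_deriv i (\<lambda>y. ?e j) x \<cdot> coeff_deriv j \<omega> x) S + (?e j \<cdot> H i j) S)"
          unfolding H_def by (intro coeff_deriv_mult smooth) auto
        moreover have "coeff_deriv i (\<lambda>y. ?e j) x = (\<lambda>S. 0)" by (simp add: coeff_deriv_def fun_eq_iff)
        ultimately show "coeff_deriv i (\<lambda>y. ?e j \<cdot> coeff_deriv j \<omega> y) x S = (?e j \<cdot> H i j) S" by simp
      qed
      finally show "coeff_deriv i (ext_deriv U \<omega>) x S = (\<Sum>j<4. (?e j \<cdot> H i j) S)" .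
    qed
    have eq: "ext_deriv U (ext_deriv U \<omega>) x S = (\<Sum>i<4. \<Sum>j<4. (?e i \<cdot> ?e j \<cdot> H i j) S)" for S
      by (simp add: ext_deriv_eq_sum[OF ext_deriv_forms[OF U \<omega>] True] dd ext_mult_sum_right ext_mult_assoc)
    have anti: "(?e i \<cdot> ?e j \<cdot> H i j) S = - (?e j \<cdot> ?e i \<cdot> H j i) S" if "i < 4" "j < 4" for i j S
    proof -
      have "?e i \<cdot> ?e j = (\<lambda>S. - 1 * (?e j \<cdot> ?e i) S)"
        using degree_one_anticommute[OF gen_degree_one[OF that(1)] gen_degree_one[OF that(2)]] by simp
      then have "?e i \<cdot> ?e j \<cdot> H i j = (\<lambda>S. - 1 * (?e j \<cdot> ?e i \<cdot> H i j) S)"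
        by (simp only: ext_mult_scale_left)
      then show ?thesis by (simp add: H_sym[OF that])
    qed
    show ?thesis
    proof
      fix S
      have "(\<Sum>i<4. \<Sum>j<4. (?e i \<cdot> ?e j \<cdot> H i j) S) = (\<Sum>i<4. \<Sum>j<4. - (?e j \<cdot> ?e i \<cdot> H j i) S)"
        by (intro sum.cong refl anti) auto
      also have "\<dots> = - (\<Sum>i<4. \<Sum>j<4. (?e j \<cdot> ?e i \<cdot> H j i) S)" by (simp add: sum_negf)
      also have "(\<Sum>i<4. \<Sum>j<4. (?e j \<cdot> ?e i \<cdot> H j i) S) = (\<Sum>i<4. \<Sum>j<4. (?e i \<cdot> ?e j \<cdot> H i j) S)"
        by (rule sum.swap)
      finally show "ext_deriv U (ext_deriv U \<omega>) x S = 0" unfolding eq by (simp add: equal_neg_zero)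
    qed
  qed
qed

section \<open>Quotients of complex algebras\<close>

text \<open>
  The part of the axioms of an associative algebra that makes scalar multiplication on a
  quotient by an ideal well defined.
\<close>

locale complex_alg = ring A for A :: "(complex, 'a) module" (structure) +
  assumes smult_closed: "x \<in> carrier A \<Longrightarrow> c \<odot> x \<in> carrier A"
    and smult_add: "x \<in> carrier A \<Longrightarrow> y \<in> carrier A \<Longrightarrow> c \<odot> (x \<oplus> y) = c \<odot> x \<oplus> c \<odot> y"
    and smult_mult: "x \<in> carrier A \<Longrightarrow> y \<in> carrier A \<Longrightarrow> c \<odot> (x \<otimes> y) = (c \<odot> x) \<otimes> y"
begin

lemma ideal_smult:
  assumes "ideal I A" "x \<in> I"
  shows "c \<odot> x \<in> I"
proof -
  interpret ideal I A by fact
  have x: "x \<in> carrier A" using assms(2) by (rule a_Hcarr)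
  then have "c \<odot> x = (c \<odot> \<one>) \<otimes> x" using smult_mult[of \<one> x c] by simp
  then show ?thesis using assms(2) I_l_closed smult_closed by simp
qed

lemma quot_smult:
  assumes I: "ideal I A" and a: "a \<in> carrier A"
  shows "c \<odot>\<^bsub>alg_quot A I\<^esub> (I +> a) = I +> (c \<odot> a)"
proof -
  interpret ideal I A by fact
  have "I +> (c \<odot> x) = I +> (c \<odot> a)" if x: "x \<in> I +> a" for x
  proof -
    obtain i where i: "i \<in> I" "x = i \<oplus> a" using x by (auto simp: a_r_coset_def')
    then have "c \<odot> x = c \<odot> i \<oplus> c \<odot> a" using a by (simp add: smult_add a_Hcarr)
    then have "c \<odot> x \<in> I +> (c \<odot> a)" using ideal_smult[OF I i(1)] by (auto simp: a_r_coset_def')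
    from a_repr_independence[OF this smult_closed[OF a] a_subgroup] show ?thesis ..
  qed
  moreover have "a \<in> I +> a" using a by (rule a_rcos_self)
  ultimately have "(\<Union>x\<in>I +> a. I +> (c \<odot> x)) = I +> (c \<odot> a)"
    by (intro SUP_eq_const) blast+
  then show ?thesis by (simp add: alg_quot_def)
qed

lemma ring_alg_quot:
  assumes "ideal I A"
  shows "ring (alg_quot A I)"
proof -
  interpret Q: ring "A Quot I" using assms by (rule ideal.quotient_is_ring)
  show ?thesis
  proof (rule ringI)
    show "abelian_group (alg_quot A I)"
      by (rule abelian_groupI)
         (use Q.a_assoc Q.a_comm Q.l_zero Q.add.l_inv_ex Q.add.m_closed Q.zero_closed in \<open>auto simp: alg_quot_def\<close>)
    show "monoid (alg_quot A I)"
      by (rule monoidI) (use Q.m_assoc Q.l_one Q.r_one Q.m_closed Q.one_closed in \<open>auto simp: alg_quot_def\<close>)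
  qed (use Q.l_distr Q.r_distr in \<open>auto simp: alg_quot_def\<close>)
qed

lemma coset_graded_alg_hom:
  assumes "ideal I A"
  shows "graded_alg_hom A G (alg_quot A I) (quot_grading A I G) ((+>) I)"
proof -
  have "(+>) I \<in> ring_hom A (A Quot I)" using assms by (rule ideal.rcos_ring_hom)
  then have "(+>) I \<in> ring_hom A (alg_quot A I)" by (simp add: ring_hom_def alg_quot_def)
  then show ?thesis
    by (simp add: graded_alg_hom_def quot_smult[OF assms] quot_grading_def)
qed

text \<open>
  A homomorphism that vanishes on an ideal is constant on its cosets, so it can be evaluated
  on a coset through any representative.
\<close>

lemma graded_alg_hom_factor:
  assumes I: "ideal I A" and h: "graded_alg_hom A G B H h" and B: "ring B"
    and G: "\<And>p. G p \<subseteq> carrier A" and van: "\<And>a. a \<in> I \<Longrightarrow> h a = \<zero>\<^bsub>B\<^esub>"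
  shows "\<exists>\<Psi>. graded_alg_hom (alg_quot A I) (quot_grading A I G) B H \<Psi> \<and>
    (\<forall>a\<in>carrier A. h a = \<Psi> (I +> a))"
proof -
  interpret ideal I A by fact
  interpret B: ring B by fact
  have hr: "h \<in> ring_hom A B" and hs: "\<And>c x. x \<in> carrier A \<Longrightarrow> h (c \<odot> x) = c \<odot>\<^bsub>B\<^esub> h x"
    and hg: "\<And>p. h ` G p \<subseteq> H p"
    using h by (auto simp: graded_alg_hom_def)
  define \<Psi> where "\<Psi> X = h (SOME a. a \<in> X)" for X
  have \<Psi>: "\<Psi> (I +> a) = h a" if a: "a \<in> carrier A" for a
  proof -
    have "(SOME x. x \<in> I +> a) \<in> I +> a" using a_rcos_self[OF a] by (rule someI)
    then obtain i where i: "i \<in> I" "(SOME x. x \<in> I +> a) = i \<oplus> a" by (auto simp: a_r_coset_def')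
    then have "\<Psi> (I +> a) = h i \<oplus>\<^bsub>B\<^esub> h a"
      using ring_hom_add[OF hr a_Hcarr[OF i(1)] a] by (simp add: \<Psi>_def)
    then show ?thesis using van[OF i(1)] ring_hom_closed[OF hr a] by simp
  qed
  have coset: "\<exists>a\<in>carrier A. X = I +> a" if "X \<in> carrier (alg_quot A I)" for X
    using that by (auto simp: alg_quot_def FactRing_def A_RCOSETS_def')
  have q: "(+>) I \<in> ring_hom A (alg_quot A I)"
    using coset_graded_alg_hom[OF I, of G] by (simp add: graded_alg_hom_def)
  have "\<Psi> \<in> ring_hom (alg_quot A I) B"
  proof (rule ring_hom_memI)
    fix X assume "X \<in> carrier (alg_quot A I)"
    then obtain a where "a \<in> carrier A" "X = I +> a" using coset by blast
    then show "\<Psi> X \<in> carrier B" using ring_hom_closed[OF hr] by (simp add: \<Psi>)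
  next
    fix X Y assume "X \<in> carrier (alg_quot A I)" "Y \<in> carrier (alg_quot A I)"
    then obtain a b where ab: "a \<in> carrier A" "X = I +> a" "b \<in> carrier A" "Y = I +> b"
      using coset by blast
    show "\<Psi> (X \<otimes>\<^bsub>alg_quot A I\<^esub> Y) = \<Psi> X \<otimes>\<^bsub>B\<^esub> \<Psi> Y"
      using \<Psi>[OF m_closed[OF ab(1,3)]] ab ring_hom_mult[OF q ab(1,3)] ring_hom_mult[OF hr ab(1,3)]
      by (simp add: \<Psi>)
    show "\<Psi> (X \<oplus>\<^bsub>alg_quot A I\<^esub> Y) = \<Psi> X \<oplus>\<^bsub>B\<^esub> \<Psi> Y"
      using \<Psi>[OF add.m_closed[OF ab(1,3)]] ab ring_hom_add[OF q ab(1,3)] ring_hom_add[OF hr ab(1,3)]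
      by (simp add: \<Psi>)
  next
    show "\<Psi> \<one>\<^bsub>alg_quot A I\<^esub> = \<one>\<^bsub>B\<^esub>"
      using \<Psi>[OF one_closed] ring_hom_one[OF q] ring_hom_one[OF hr] by simp
  qed
  moreover have "\<Psi> (c \<odot>\<^bsub>alg_quot A I\<^esub> X) = c \<odot>\<^bsub>B\<^esub> \<Psi> X" if X: "X \<in> carrier (alg_quot A I)" for c X
  proof -
    obtain a where "a \<in> carrier A" "X = I +> a" using coset[OF X] by blast
    then show ?thesis by (simp add: quot_smult[OF I] \<Psi> smult_closed hs)
  qed
  moreover have "\<Psi> ` quot_grading A I G p \<subseteq> H p" for p
    using hg[of p] G[of p] by (auto simp: quot_grading_def \<Psi> subset_iff image_subset_iff)
  ultimately show ?thesis using \<Psi> by (intro exI[of _ \<Psi>]) (auto simp: graded_alg_hom_def)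
qed

end

lemma graded_alg_hom_comp:
  assumes h: "graded_alg_hom A G B H h" and k: "graded_alg_hom B H C K k"
  shows "graded_alg_hom A G C K (\<lambda>x. k (h x))"
proof -
  have r: "h \<in> ring_hom A B" "k \<in> ring_hom B C" using assms by (auto simp: graded_alg_hom_def)
  have "(\<lambda>x. k (h x)) \<in> ring_hom A C"
    using r by (auto intro!: ring_hom_memI simp: ring_hom_closed ring_hom_mult ring_hom_add ring_hom_one)
  then show ?thesis
    using assms ring_hom_closed[OF r(1)] unfolding graded_alg_hom_def by (auto simp: image_subset_iff)
qed

lemma (in complex_alg) graded_alg_hom_restrict:
  assumes h: "graded_alg_hom A G B H h" and G: "\<And>p. G p \<subseteq> carrier A"
  shows "graded_alg_hom A G B H (restrict h (carrier A))"
proof -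
  have "restrict h (carrier A) \<in> ring_hom A B"
    using h unfolding graded_alg_hom_def by (auto simp: ring_hom_def)
  moreover have "restrict h (carrier A) ` G p = h ` G p" for p using G[of p] by (auto simp: subset_iff)
  ultimately show ?thesis using h by (simp add: graded_alg_hom_def smult_closed)
qed

lemma complex_alg_ext_alg: "complex_alg (ext_alg m)"
proof -
  interpret ring "ext_alg m" by (rule ring_ext_alg)
  show ?thesis
    by unfold_locales (auto simp: ext_alg_def distrib_left ext_mult_scale_left)
qed

lemma ext_alg_ops [simp]:
  "mult (ext_alg m) = ext_mult" "one (ext_alg m) = ext_monom {}" "zero (ext_alg m) = (\<lambda>S. 0)"
  "add (ext_alg m) = (\<lambda>a b S. a S + b S)" "smult (ext_alg m) = (\<lambda>c a S. c * a S)"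
  by (simp_all add: ext_alg_def)

lemma ext_monom_carrier: "S \<subseteq> {..<m} \<Longrightarrow> ext_monom S \<in> carrier (ext_alg m)"
  using ext_monom_grading by (auto simp: ext_grading_def)

lemma ext_grading_carrier: "ext_grading m p \<subseteq> carrier (ext_alg m)"
  by (auto simp: ext_grading_def)

text \<open>
  Homomorphisms that agree on the generators agree on monomials and hence, adding one monomial
  at a time, on all linear combinations of monomials.
\<close>

lemma ext_alg_hom_unique:
  assumes h: "graded_alg_hom (ext_alg m) G B H h" and k: "graded_alg_hom (ext_alg m) G B H k"
    and eq: "\<And>i. i < m \<Longrightarrow> h (ext_monom {i}) = k (ext_monom {i})" and a: "a \<in> carrier (ext_alg m)"
  shows "h a = k a"
proof -
  let ?E = "ext_alg m"
  have hr: "h \<in> ring_hom ?E B" and kr: "k \<in> ring_hom ?E B"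
    and hs: "\<And>c x. x \<in> carrier ?E \<Longrightarrow> h (\<lambda>S. c * x S) = c \<odot>\<^bsub>B\<^esub> h x"
    and ks: "\<And>c x. x \<in> carrier ?E \<Longrightarrow> k (\<lambda>S. c * x S) = c \<odot>\<^bsub>B\<^esub> k x"
    using h k by (auto simp: graded_alg_hom_def)
  have mon: "h (ext_monom S) = k (ext_monom S)" if S: "S \<subseteq> {..<m}" for S
  proof -
    have "finite S" using S by (rule finite_subset) simp
    then show ?thesis using S
    proof (induct S rule: finite_induct_min)
      case empty
      then show ?case using ring_hom_one[OF hr] ring_hom_one[OF kr] by simp
    next
      case (insert i S)
      have c: "ext_monom {i} \<in> carrier ?E" "ext_monom S \<in> carrier ?E"
        using insert(4) by (auto intro: ext_monom_carrier)
      show ?case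
        using ring_hom_mult[OF hr c] ring_hom_mult[OF kr c] eq[of i] insert
        by (simp add: ext_monom_insert_min)
    qed
  qed
  have "h a = k a" if "finite N" "a \<in> carrier ?E" "\<And>S. S \<notin> N \<Longrightarrow> a S = 0" "N \<subseteq> Pow {..<m}" for N a
    using that
  proof (induct N arbitrary: a rule: finite_induct)
    case empty
    \<comment> \<open>As a scalar multiple of \<open>1\<close>, zero has the same image under both maps.\<close>
    then have "a = (\<lambda>S. 0 * ext_monom {} S)" by auto
    then show ?case using hs[of "ext_monom {}" 0] ks[of "ext_monom {}" 0] mon[of "{}"]
      by (simp add: ext_monom_carrier del: mult_zero_left)
  next
    case (insert T N)
    define b where "b S = (if S = T then 0 else a S)" for S
    have b: "b \<in> carrier ?E" using insert(4) by (simp add: b_def ext_alg_carrier_iff)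
    have hb: "h b = k b" by (rule insert(3)[OF b]) (use insert(5,6) in \<open>auto simp: b_def\<close>)
    have T: "ext_monom T \<in> carrier ?E" "h (ext_monom T) = k (ext_monom T)"
      using insert(6) by (auto intro: ext_monom_carrier mon)
    have t: "(\<lambda>S. a T * ext_monom T S) \<in> carrier ?E" using T(1) by (simp add: ext_alg_carrier_iff)
    have "a = (\<lambda>S. a T * ext_monom T S) \<oplus>\<^bsub>?E\<^esub> b" by (auto simp: b_def ext_monom_def)
    moreover have "h ((\<lambda>S. a T * ext_monom T S) \<oplus>\<^bsub>?E\<^esub> b) = k ((\<lambda>S. a T * ext_monom T S) \<oplus>\<^bsub>?E\<^esub> b)"
      unfolding ring_hom_add[OF hr t b] ring_hom_add[OF kr t b] hb hs[OF T(1)] ks[OF T(1)] T(2) ..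
    ultimately show ?case by metis
  qed
  from this[of "Pow {..<m}" a] a show ?thesis by (simp add: ext_alg_carrier_iff)
qed

section \<open>The de Rham algebra and its cohomology\<close>

lemma closed_forms_iff:
  "\<omega> \<in> carrier (closed_forms U) \<longleftrightarrow> \<omega> \<in> forms U \<and> ext_deriv U \<omega> = (\<lambda>x S. 0)"
  by (simp add: closed_forms_def)

lemma closed_forms_ops [simp]:
  "mult (closed_forms U) = (\<lambda>\<alpha> \<beta> x. \<alpha> x \<cdot> \<beta> x)"
  "one (closed_forms U) = (\<lambda>x. if x \<in> U then ext_monom {} else (\<lambda>S. 0))"
  "zero (closed_forms U) = (\<lambda>x S. 0)"
  "add (closed_forms U) = (\<lambda>\<alpha> \<beta> x S. \<alpha> x S + \<beta> x S)"
  "smult (closed_forms U) = (\<lambda>c \<alpha> x S. c * \<alpha> x S)"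
  by (simp_all add: closed_forms_def)

lemma closed_zero: "(\<lambda>x S. 0) \<in> carrier (closed_forms U)"
  by (simp add: closed_forms_iff forms_zero ext_deriv_def fun_eq_iff)

context
  fixes U :: "pt set"
  assumes U: "open U"
begin

lemma closed_add:
  "\<alpha> \<in> carrier (closed_forms U) \<Longrightarrow> \<beta> \<in> carrier (closed_forms U) \<Longrightarrow>
    (\<lambda>x S. \<alpha> x S + \<beta> x S) \<in> carrier (closed_forms U)"
  by (simp add: closed_forms_iff forms_add[OF U] ext_deriv_add)

lemma closed_scale:
  "\<alpha> \<in> carrier (closed_forms U) \<Longrightarrow> (\<lambda>x S. c * \<alpha> x S) \<in> carrier (closed_forms U)"
  using forms_scale[OF U, of \<alpha> "\<lambda>S. c"] by (simp add: closed_forms_iff ext_deriv_scale)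

lemma closed_mult:
  "\<alpha> \<in> carrier (closed_forms U) \<Longrightarrow> \<beta> \<in> carrier (closed_forms U) \<Longrightarrow>
    (\<lambda>x. \<alpha> x \<cdot> \<beta> x) \<in> carrier (closed_forms U)"
  by (simp add: closed_forms_iff forms_mult[OF U] ext_deriv_mult[OF U])

lemma closed_one: "(\<lambda>x. if x \<in> U then ext_monom {} else (\<lambda>S. 0)) \<in> carrier (closed_forms U)"
  (is "?o \<in> _")
proof -
  have c: "(\<lambda>x. ?o x S) x = (\<lambda>x. ext_monom {} S) x" if "x \<in> U" for x S using that by simp
  have "?o \<in> forms U"
  proof (rule formsI)
    fix S show "C_infinity_on U (\<lambda>x. ?o x S)"
      by (subst C_infinity_on_cong[OF U c]) auto
  qed (simp_all add: ext_monom_carrier)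
  moreover have "pderiv_coord j (\<lambda>y. ?o y S) x = 0" if "x \<in> U" for j S x
    using pderiv_coord_cong[of U x "\<lambda>y. ?o y S" "\<lambda>y. ext_monom {} S" j] U that by simp
  then have "ext_deriv U ?o = (\<lambda>x S. 0)" by (intro ext) (simp add: ext_deriv_def)
  ultimately show ?thesis by (simp add: closed_forms_iff)
qed

lemma closed_sum:
  "(\<And>i. i \<in> N \<Longrightarrow> \<alpha> i \<in> carrier (closed_forms U)) \<Longrightarrow>
    (\<lambda>x S. \<Sum>i\<in>N. \<alpha> i x S) \<in> carrier (closed_forms U)"
  by (induct N rule: infinite_finite_induct) (simp_all add: closed_zero closed_add)

lemma complex_alg_closed_forms: "complex_alg (closed_forms U)"
proof (rule complex_alg.intro)
  show "ring (closed_forms U)"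
  proof (rule ringI)
    show "abelian_group (closed_forms U)"
    proof (rule abelian_groupI)
      fix \<alpha> assume a: "\<alpha> \<in> carrier (closed_forms U)"
      show "\<exists>\<beta>\<in>carrier (closed_forms U). \<beta> \<oplus>\<^bsub>closed_forms U\<^esub> \<alpha> = \<zero>\<^bsub>closed_forms U\<^esub>"
        using closed_scale[OF a, of "- 1"] by (intro bexI[of _ "\<lambda>x S. - 1 * \<alpha> x S"]) simp_all
    qed (simp_all add: closed_add closed_zero add_ac)
    show "monoid (closed_forms U)"
    proof (rule monoidI)
      fix \<alpha> assume "\<alpha> \<in> carrier (closed_forms U)"
      then have a: "\<alpha> \<in> forms U" by (simp add: closed_forms_iff)
      show "\<one>\<^bsub>closed_forms U\<^esub> \<otimes>\<^bsub>closed_forms U\<^esub> \<alpha> = \<alpha>"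
        using a by (intro ext) (simp add: ext_mult_one_left[OF forms_carrier] forms_outside)
      show "\<alpha> \<otimes>\<^bsub>closed_forms U\<^esub> \<one>\<^bsub>closed_forms U\<^esub> = \<alpha>"
        using a by (intro ext) (simp add: ext_mult_one_right[OF forms_carrier] forms_outside)
    qed (simp_all add: closed_mult closed_one ext_mult_assoc)
  qed (simp_all add: ext_mult_add_left ext_mult_add_right)
qed (unfold_locales, simp_all add: closed_scale distrib_left ext_mult_scale_left)

text \<open>
  For closed \<open>\<beta>\<close> the Leibniz rule gives \<open>d\<eta> \<and> \<beta> = d(\<eta> \<and> \<beta>)\<close>.  Multiplying from the left one has
  to correct by the grade involution \<open>\<epsilon>\<close>: \<open>\<beta> \<and> d\<eta> = d(\<epsilon>(\<beta>) \<and> \<eta>)\<close>, where \<open>\<epsilon>(\<beta>)\<close> is again closed.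
\<close>

lemma ideal_exact_forms: "ideal (exact_forms U) (closed_forms U)"
proof -
  interpret complex_alg "closed_forms U" by (rule complex_alg_closed_forms)
  have sub: "exact_forms U \<subseteq> carrier (closed_forms U)"
    by (auto simp: exact_forms_def closed_forms_iff ext_deriv_forms[OF U] ext_deriv_ext_deriv[OF U])
  have inv: "\<ominus>\<^bsub>closed_forms U\<^esub> \<alpha> = (\<lambda>x S. - 1 * \<alpha> x S)" if "\<alpha> \<in> carrier (closed_forms U)" for \<alpha>
    by (rule minus_equality) (use that closed_scale[OF that, of "- 1"] in simp_all)
  show ?thesis
  proof (rule idealI[OF ring_axioms])
    show "subgroup (exact_forms U) (add_monoid (closed_forms U))"
    proof (rule add.subgroupI[OF sub])
      show "exact_forms U \<noteq> {}" using forms_zero by (auto simp: exact_forms_def)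
    next
      fix \<alpha> assume a: "\<alpha> \<in> exact_forms U"
      then obtain \<eta> where \<eta>: "\<eta> \<in> forms U" "\<alpha> = ext_deriv U \<eta>" by (auto simp: exact_forms_def)
      have "\<ominus>\<^bsub>closed_forms U\<^esub> \<alpha> = ext_deriv U (\<lambda>x S. - 1 * \<eta> x S)"
        unfolding ext_deriv_scale[OF \<eta>(1)] using inv[of \<alpha>] a sub \<eta>(2) by auto
      moreover have "(\<lambda>x S. - 1 * \<eta> x S) \<in> forms U" using forms_scale[OF U \<eta>(1), of "\<lambda>S. - 1"] .
      ultimately show "\<ominus>\<^bsub>closed_forms U\<^esub> \<alpha> \<in> exact_forms U" unfolding exact_forms_def by blast
    next
      fix \<alpha> \<beta> assume "\<alpha> \<in> exact_forms U" "\<beta> \<in> exact_forms U"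
      then obtain \<eta> \<theta> where "\<eta> \<in> forms U" "\<alpha> = ext_deriv U \<eta>" "\<theta> \<in> forms U" "\<beta> = ext_deriv U \<theta>"
        by (auto simp: exact_forms_def)
      then show "\<alpha> \<oplus>\<^bsub>closed_forms U\<^esub> \<beta> \<in> exact_forms U"
        unfolding exact_forms_def using ext_deriv_add[of \<eta> U \<theta>] forms_add[OF U, of \<eta> \<theta>]
        by (auto intro!: image_eqI[of _ _ "\<lambda>x S. \<eta> x S + \<theta> x S"])
    qed
  next
    fix \<alpha> \<beta> assume "\<alpha> \<in> exact_forms U" and b: "\<beta> \<in> carrier (closed_forms U)"
    then obtain \<eta> where \<eta>: "\<eta> \<in> forms U" "\<alpha> = ext_deriv U \<eta>" by (auto simp: exact_forms_def)
    have b': "\<beta> \<in> forms U" "ext_deriv U \<beta> = (\<lambda>x S. 0)" using b by (auto simp: closed_forms_iff)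
    have "ext_deriv U (\<lambda>x. \<eta> x \<cdot> \<beta> x) = (\<lambda>x. \<alpha> x \<cdot> \<beta> x)"
      by (simp add: ext_deriv_mult[OF U \<eta>(1) b'(1)] b'(2) \<eta>(2))
    then show "\<alpha> \<otimes>\<^bsub>closed_forms U\<^esub> \<beta> \<in> exact_forms U"
      unfolding exact_forms_def using forms_mult[OF U \<eta>(1) b'(1)]
      by (auto intro!: image_eqI[of _ _ "\<lambda>x. \<eta> x \<cdot> \<beta> x"])
    have gf: "(\<lambda>x. grade_invol (\<beta> x)) \<in> forms U"
      using forms_scale[OF U b'(1), of "\<lambda>S. (- 1) ^ card S"] by (simp add: grade_invol_def[abs_def])
    have gg: "grade_invol (grade_invol b) = b" for b
      by (simp add: grade_invol_def fun_eq_iff mult.assoc[symmetric] power_mult_distrib[symmetric])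
    have z: "ext_deriv U (\<lambda>x. grade_invol (\<beta> x)) = (\<lambda>x S. 0)"
      unfolding ext_deriv_grade_invol[OF b'(1)] b'(2) by (simp add: grade_invol_def)
    have "ext_deriv U (\<lambda>x. grade_invol (\<beta> x) \<cdot> \<eta> x) = (\<lambda>x. \<beta> x \<cdot> \<alpha> x)"
      by (simp add: ext_deriv_mult[OF U gf \<eta>(1)] z gg \<eta>(2))
    then show "\<beta> \<otimes>\<^bsub>closed_forms U\<^esub> \<alpha> \<in> exact_forms U"
      unfolding exact_forms_def using forms_mult[OF U gf \<eta>(1)]
      by (auto intro!: image_eqI[of _ _ "\<lambda>x. grade_invol (\<beta> x) \<cdot> \<eta> x"])
  qed
qed

end

text \<open>
  The universal map applied at each point of \<open>U\<close>.  The case distinction makes the image of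
  \<open>1\<close>, like every form, vanish outside \<open>U\<close>.
\<close>

definition form_hom ::
  "pt set \<Rightarrow> nat \<Rightarrow> (nat \<Rightarrow> dform) \<Rightarrow> (nat set \<Rightarrow> complex) \<Rightarrow> dform" where
  "form_hom U m \<omega> a = (\<lambda>x. if x \<in> U then ext_hom m (\<lambda>i. \<omega> i x) a else (\<lambda>S. 0))"

text \<open>
  Being a homomorphism is a pointwise matter.  That the values are closed forms holds because
  ordered products of closed forms are closed.
\<close>

lemma form_hom_graded:
  assumes U: "open U" and deg: "\<And>i x. \<omega> i x \<in> ext_grading 4 1"
    and cl: "\<And>i. i < m \<Longrightarrow> \<omega> i \<in> carrier (closed_forms U)"
  shows "graded_alg_hom (ext_alg m) (ext_grading m) (closed_forms U) (closed_grading U) (form_hom U m \<omega>)"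
proof -
  have prod: "(\<lambda>x. if x \<in> U then ordered_prod (\<lambda>i. \<omega> i x) S else (\<lambda>S. 0)) \<in> carrier (closed_forms U)"
    if S: "S \<subseteq> {..<m}" for S
  proof -
    have "finite S" using S by (rule finite_subset) simp
    then show ?thesis using S
    proof (induct S rule: finite_induct_min)
      case empty
      then show ?case unfolding ordered_prod_empty by (simp add: closed_one[OF U])
    next
      case (insert i S)
      have "(\<lambda>x. \<omega> i x \<cdot> (if x \<in> U then ordered_prod (\<lambda>i. \<omega> i x) S else (\<lambda>S. 0)))
          \<in> carrier (closed_forms U)"
        by (rule closed_mult[OF U]) (use cl insert in auto)
      moreover have "(\<lambda>x. if x \<in> U then ordered_prod (\<lambda>i. \<omega> i x) (insert i S) else (\<lambda>S. 0)) =
          (\<lambda>x. \<omega> i x \<cdot> (if x \<in> U then ordered_prod (\<lambda>i. \<omega> i x) S else (\<lambda>S. 0)))"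
        using ordered_prod_insert_min[OF insert(1,2)] by auto
      ultimately show ?case by simp
    qed
  qed
  have closed: "form_hom U m \<omega> a \<in> carrier (closed_forms U)" for a
  proof -
    have "form_hom U m \<omega> a = (\<lambda>x R. \<Sum>S\<in>Pow {..<m}.
        a S * (if x \<in> U then ordered_prod (\<lambda>i. \<omega> i x) S else (\<lambda>S. 0)) R)"
      by (intro ext) (simp add: form_hom_def ext_hom_def)
    then show ?thesis by (simp only:) (intro closed_sum[OF U] closed_scale[OF U] prod, simp)
  qed
  have "form_hom U m \<omega> \<in> ring_hom (ext_alg m) (closed_forms U)"
    by (rule ring_hom_memI, rule closed)
       (auto simp: form_hom_def ext_hom_mult[OF deg] ext_hom_add ext_hom_one)
  moreover have "form_hom U m \<omega> a \<in> closed_grading U p" if "a \<in> ext_grading m p" for a p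
    using closed[of a] ext_hom_grading[OF deg that]
    by (auto simp: closed_grading_def form_hom_def ext_grading_def)
  ultimately show ?thesis
    by (auto simp: graded_alg_hom_def form_hom_def ext_hom_scale)
qed

section \<open>Logarithmic forms\<close>

lemma zero_form_forms:
  assumes U: "open U" and g: "C_infinity_on U g"
  shows "zero_form U g \<in> forms U"
proof (rule formsI)
  fix S show "C_infinity_on U (\<lambda>x. zero_form U g x S)"
    using g C_infinity_on_cong[OF U, of "\<lambda>x. zero_form U g x S" g]
    by (cases "S = {}") (simp_all add: zero_form_def)
qed (auto simp: zero_form_def ext_alg_carrier_iff fun_eq_iff)

lemma zero_form_mult:
  assumes "b \<in> carrier (ext_alg n)" "x \<in> U"
  shows "zero_form U g x \<cdot> b = (\<lambda>S. g x * b S)"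
proof -
  have "zero_form U g x = (\<lambda>S. g x * ext_monom {} S)"
    using assms(2) by (auto simp: zero_form_def ext_monom_def)
  then show ?thesis by (simp add: ext_mult_scale_left ext_mult_one_left[OF assms(1)])
qed

lemma ext_deriv_zero_form:
  assumes U: "open U" and g: "C_infinity_on U g" and x: "x \<in> U"
  shows "ext_deriv U (zero_form U g) x = (\<lambda>S. \<Sum>j<4. pderiv_coord j g x * ext_monom {j} S)"
proof
  fix S
  have "coeff_deriv j (zero_form U g) x T = (if T = {} then pderiv_coord j g x else 0)" for j T
    unfolding coeff_deriv_def
    using pderiv_coord_cong[of U x "\<lambda>y. zero_form U g y T" "\<lambda>y. if T = {} then g y else 0" j] U x
    by (auto simp: zero_form_def)
  then have "(ext_monom {j} \<cdot> coeff_deriv j (zero_form U g) x) S = pderiv_coord j g x * ext_monom {j} S" for j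
    unfolding ext_monom_singleton_mult by (auto simp: ext_monom_def)
  then show "ext_deriv U (zero_form U g) x S = (\<Sum>j<4. pderiv_coord j g x * ext_monom {j} S)"
    by (simp add: ext_deriv_eq_sum[OF zero_form_forms[OF U g] x])
qed

lemma ext_deriv_zero_form_degree:
  "x \<in> U \<Longrightarrow> open U \<Longrightarrow> C_infinity_on U g \<Longrightarrow> ext_deriv U (zero_form U g) x \<in> ext_grading 4 1"
  unfolding ext_deriv_zero_form
  by (auto simp: ext_grading_def ext_alg_carrier_iff ext_monom_def intro!: sum.neutral)

lemma eval2_0: "eval2 0 x = 0"
  by (simp add: eval2_def)

lemma eval2_pCons: "eval2 (pCons a p) x = poly a (fst x) + snd x * eval2 p x"
  by (simp add: eval2_def)

lemma C_infinity_on_eval2: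
  assumes U: "open U"
  shows "C_infinity_on U (eval2 p)"
proof -
  have fs: "C_infinity_on U (fst :: pt \<Rightarrow> complex)" "C_infinity_on U (snd :: pt \<Rightarrow> complex)"
    by (intro C_infinity_on_linear bounded_linear_fst bounded_linear_snd)+
  have pl: "C_infinity_on U (\<lambda>x. poly a (fst x))" for a
    by (induct a) (auto intro!: C_infinity_on_add[OF U] C_infinity_on_mult[OF U] fs)
  have "C_infinity_on U (\<lambda>x. eval2 p x)"
    by (induct p) (auto simp: eval2_0 eval2_pCons intro!: C_infinity_on_add[OF U] C_infinity_on_mult[OF U] fs pl)
  then show ?thesis by (simp add: eta_contract_eq)
qed

text \<open>
  Polynomials are holomorphic: their real derivative is complex linear.
\<close>

lemma eval2_has_derivative:
  "\<exists>A B. (eval2 p has_derivative (\<lambda>h. A * fst h + B * snd h)) (at x)"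
proof (induct p)
  case 0
  have "eval2 0 = (\<lambda>x. 0)" by (simp add: fun_eq_iff eval2_0)
  then show ?case by (intro exI[of _ 0]) simp
next
  case (pCons a p)
  then obtain A B where p: "(eval2 p has_derivative (\<lambda>h. A * fst h + B * snd h)) (at x)" by blast
  have a: "((\<lambda>x. poly a (fst x)) has_derivative (\<lambda>h. poly (pderiv a) (fst x) * fst h)) (at x)"
    by (rule has_derivative_compose[OF has_derivative_fst[OF has_derivative_ident]
          poly_DERIV[THEN has_field_derivative_imp_has_derivative]])
  have e: "eval2 (pCons a p) = (\<lambda>x. poly a (fst x) + snd x * eval2 p x)"
    by (simp add: fun_eq_iff eval2_pCons)
  have "(eval2 (pCons a p) has_derivative
      (\<lambda>h. poly (pderiv a) (fst x) * fst h + (snd x * (A * fst h + B * snd h) + snd h * eval2 p x))) (at x)"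
    unfolding e by (intro has_derivative_add a has_derivative_mult has_derivative_snd has_derivative_ident p)
  moreover have "(\<lambda>h. poly (pderiv a) (fst x) * fst h + (snd x * (A * fst h + B * snd h) + snd h * eval2 p x)) =
      (\<lambda>h. (poly (pderiv a) (fst x) + snd x * A) * fst h + (snd x * B + eval2 p x) * snd h)"
    by (simp add: fun_eq_iff algebra_simps)
  ultimately show ?case by metis
qed

text \<open>
  The values of the differentials of the two complex coordinates, \<open>dz = dx\<^sub>0 + \<i> dx\<^sub>1\<close> and
  \<open>dw = dx\<^sub>2 + \<i> dx\<^sub>3\<close>.
\<close>

definition dz :: "nat set \<Rightarrow> complex" where
  "dz S = ext_monom {0} S + \<i> * ext_monom {1} S"

definition dw :: "nat set \<Rightarrow> complex" where
  "dw S = ext_monom {2} S + \<i> * ext_monom {3} S"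

lemma dz_dw_degree: "dz \<in> ext_grading 4 1" "dw \<in> ext_grading 4 1"
  by (auto simp: dz_def dw_def ext_grading_def ext_alg_carrier_iff ext_monom_def)

lemma log_form_type_one_zero:
  assumes U: "open U" and x: "x \<in> U"
  shows "\<exists>A B. log_form U p x = (\<lambda>S. A * dz S + B * dw S)"
proof -
  obtain A B where "(eval2 p has_derivative (\<lambda>h. A * fst h + B * snd h)) (at x)"
    using eval2_has_derivative by blast
  then have "pderiv_coord j (eval2 p) x = A * fst (coord_vec j) + B * snd (coord_vec j)" for j
    by (rule pderiv_coord_eq)
  then have "log_form U p x S = (A / eval2 p x) * dz S + (B / eval2 p x) * dw S" for S
    by (simp add: log_form_def ext_deriv_zero_form[OF U C_infinity_on_eval2[OF U] x] coord_vec_def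
        dz_def dw_def lessThan_nat_numeral lessThan_Suc eval_nat_numeral add_divide_distrib algebra_simps)
  then show ?thesis by (intro exI ext)
qed

lemma log_form_degree: "open U \<Longrightarrow> log_form U p x \<in> ext_grading 4 1"
proof (cases "x \<in> U")
  case True
  assume "open U"
  then show ?thesis
    using ext_deriv_zero_form_degree[OF True _ C_infinity_on_eval2]
    by (auto simp: log_form_def ext_grading_def ext_alg_carrier_iff)
next
  case False
  then show ?thesis by (auto simp: log_form_def ext_deriv_outside ext_grading_def ext_alg_carrier_iff)
qed

text \<open>
  Write \<open>dg / g\<close> as the product of the function \<open>1 / g\<close> and the exact form \<open>dg\<close>.  Its derivative
  is \<open>d(1 / g) \<and> dg\<close>, and \<open>d(1 / g)\<close> is a multiple of \<open>dg\<close>, which squares to zero.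
\<close>

lemma log_form_closed:
  assumes U: "open U" and nz: "\<And>x. x \<in> U \<Longrightarrow> eval2 p x \<noteq> 0"
  shows "log_form U p \<in> carrier (closed_forms U)"
proof -
  let ?g = "eval2 p" and ?h = "\<lambda>x. inverse (eval2 p x)"
  have g: "C_infinity_on U ?g" by (rule C_infinity_on_eval2[OF U])
  have h: "C_infinity_on U ?h" by (rule C_infinity_on_inverse[OF U g nz])
  have zg: "zero_form U ?g \<in> forms U" and zh: "zero_form U ?h \<in> forms U"
    using g h by (auto intro: zero_form_forms[OF U])
  have dg: "ext_deriv U (zero_form U ?g) \<in> forms U" by (rule ext_deriv_forms[OF U zg])
  have log: "log_form U p = (\<lambda>x. zero_form U ?h x \<cdot> ext_deriv U (zero_form U ?g) x)"
  proof
    fix x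
    show "log_form U p x = zero_form U ?h x \<cdot> ext_deriv U (zero_form U ?g) x"
    proof (cases "x \<in> U")
      case True
      then show ?thesis
        by (simp add: zero_form_mult[OF forms_carrier[OF dg]] log_form_def fun_eq_iff divide_inverse)
    next
      case False
      then show ?thesis by (simp add: log_form_def ext_deriv_outside fun_eq_iff)
    qed
  qed
  have "ext_deriv U (zero_form U ?h) x \<cdot> ext_deriv U (zero_form U ?g) x = (\<lambda>S. 0)" for x
  proof (cases "x \<in> U")
    case False
    then show ?thesis by (simp add: ext_deriv_outside)
  next
    case True
    have "?g differentiable (at x)" using g True by (rule C_infinity_on_differentiable)
    then have "pderiv_coord j ?h x = - (?h x * ?h x) * pderiv_coord j ?g x" for j
      using nz[OF True] by (simp add: pderiv_coord_inverse)
    then have "ext_deriv U (zero_form U ?h) x =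
        (\<lambda>S. - (?h x * ?h x) * ext_deriv U (zero_form U ?g) x S)"
      unfolding ext_deriv_zero_form[OF U h True] ext_deriv_zero_form[OF U g True] sum_distrib_left
      by (simp only: mult.assoc)
    then show ?thesis
      by (simp only: ext_mult_scale_left degree_one_square[OF ext_deriv_zero_form_degree[OF True U g]] mult_zero_right)
  qed
  then have "ext_deriv U (log_form U p) = (\<lambda>x S. 0)"
    unfolding log ext_deriv_mult[OF U zh dg] ext_deriv_ext_deriv[OF U zg] by simp
  moreover have "log_form U p \<in> forms U" unfolding log by (rule forms_mult[OF U zh dg])
  ultimately show ?thesis by (simp add: closed_forms_iff)
qed

text \<open>
  Three vectors in the span of two have exterior product zero: already \<open>u \<and> v\<close> is a multiple of
  \<open>\<zeta> \<and> \<eta>\<close>.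
\<close>

lemma triple_product_zero:
  assumes z: "\<zeta> \<in> ext_grading n 1" and e: "\<eta> \<in> ext_grading n 1"
    and u: "u = (\<lambda>S. A * \<zeta> S + B * \<eta> S)" and v: "v = (\<lambda>S. C * \<zeta> S + D * \<eta> S)"
    and w: "w = (\<lambda>S. E * \<zeta> S + F * \<eta> S)"
  shows "u \<cdot> v \<cdot> w = (\<lambda>S. 0)"
proof -
  note lin = ext_mult_add_left ext_mult_add_right ext_mult_scale_left ext_mult_scale_right
  have ez: "\<eta> \<cdot> \<zeta> = (\<lambda>S. - 1 * (\<zeta> \<cdot> \<eta>) S)" using degree_one_anticommute[OF e z] by simp
  have "u \<cdot> v = (\<lambda>S. (A * D - B * C) * (\<zeta> \<cdot> \<eta>) S)"
    unfolding u v lin degree_one_square[OF z] degree_one_square[OF e] ez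
    by (simp add: fun_eq_iff algebra_simps)
  moreover have "\<zeta> \<cdot> \<eta> \<cdot> \<zeta> = (\<lambda>S. 0)"
    unfolding ext_mult_assoc ez ext_mult_scale_right
    by (simp add: ext_mult_assoc[symmetric] degree_one_square[OF z])
  moreover have "\<zeta> \<cdot> \<eta> \<cdot> \<eta> = (\<lambda>S. 0)" by (simp add: ext_mult_assoc degree_one_square[OF e])
  ultimately show ?thesis unfolding w by (simp add: lin)
qed

lemma ordered_prod_vanish:
  assumes z: "\<zeta> \<in> ext_grading n 1" and e: "\<eta> \<in> ext_grading n 1"
    and v: "\<And>i. i \<in> S \<Longrightarrow> \<exists>A B. v i = (\<lambda>S. A * \<zeta> S + B * \<eta> S)" and S: "3 \<le> card S"
  shows "ordered_prod v S = (\<lambda>R. 0)"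
proof -
  have split: "\<exists>i T. S = insert i T \<and> finite T \<and> (\<forall>t\<in>T. i < t) \<and> card S = Suc (card T)"
    if "0 < card S" for S :: "nat set"
  proof (intro exI conjI)
    have S: "finite S" "S \<noteq> {}" using that by (simp_all add: card_gt_0_iff)
    then have min: "Min S \<in> S" by (rule Min_in)
    then show "S = insert (Min S) (S - {Min S})" by (simp add: insert_absorb)
    show "finite (S - {Min S})" using S(1) by simp
    show "\<forall>t\<in>S - {Min S}. Min S < t" using Min_le[OF S(1)] by (force simp: less_le)
    show "card S = Suc (card (S - {Min S}))" by (rule card.remove[OF S(1) min])
  qed
  \<comment> \<open>The three smallest indices in \<open>S\<close> give the three leftmost factors.\<close>
  obtain a T where T: "S = insert a T" "finite T" "\<forall>t\<in>T. a < t" "card S = Suc (card T)"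
    using split[of S] S by auto
  obtain b R where R: "T = insert b R" "finite R" "\<forall>t\<in>R. b < t" "card T = Suc (card R)"
    using split[of T] S T by auto
  obtain c Q where Q: "R = insert c Q" "finite Q" "\<forall>t\<in>Q. c < t" "card R = Suc (card Q)"
    using split[of R] S T R by auto
  have "ordered_prod v S = v a \<cdot> ordered_prod v T" "ordered_prod v T = v b \<cdot> ordered_prod v R"
    "ordered_prod v R = v c \<cdot> ordered_prod v Q"
    using T(3) R(3) Q(3) unfolding T(1) R(1) Q(1)
    by (intro ordered_prod_insert_min; use T(2) R(2) Q(2) R(1) Q(1) in blast)+
  then have "ordered_prod v S = v a \<cdot> v b \<cdot> v c \<cdot> ordered_prod v Q" by (simp add: ext_mult_assoc)
  moreover have "a \<in> S" "b \<in> S" "c \<in> S" using T R Q by auto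
  then have "v a \<cdot> v b \<cdot> v c = (\<lambda>S. 0)"
    using v[of a] v[of b] v[of c] triple_product_zero[OF z e] by blast
  ultimately show ?thesis by simp
qed

text \<open>
  There are no nonzero \<open>(3,0)\<close>-forms on a complex surface.  So products of three or more
  logarithmic forms vanish as forms, before passing to cohomology.
\<close>

lemma form_hom_vanish:
  assumes U: "open U" and a: "a \<in> ext_grading m p" "3 \<le> p"
  shows "form_hom U m (\<lambda>i. log_form U (f i)) a = (\<lambda>x S. 0)"
proof -
  have "a S * ordered_prod (\<lambda>i. log_form U (f i) x) S R = 0" if "x \<in> U" for x S R
  proof (cases "card S = p")
    case True
    then have "ordered_prod (\<lambda>i. log_form U (f i) x) S = (\<lambda>R. 0)"
      using ordered_prod_vanish[OF dz_dw_degree] log_form_type_one_zero[OF U that] a(2) by simp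
    then show ?thesis by simp
  qed (use a in \<open>simp add: ext_grading_def\<close>)
  then show ?thesis by (auto simp: form_hom_def ext_hom_def fun_eq_iff intro!: sum.neutral)
qed

section \<open>The canonical homomorphism\<close>

lemma open_arr_complement: "open (arr_complement m f)"
proof -
  have "continuous_on UNIV (eval2 p)" for p
    by (rule C_infinity_on_continuous[OF C_infinity_on_eval2[OF open_UNIV]])
  then have "closed (curve p)" for p unfolding curve_def by (intro closed_Collect_eq) auto
  then show ?thesis unfolding arr_complement_def by (auto intro!: closed_UN)
qed

lemma eval2_nonzero: "i < m \<Longrightarrow> x \<in> arr_complement m f \<Longrightarrow> eval2 (f i) x \<noteq> 0"
  by (auto simp: arr_complement_def curve_def)

text \<open>
  The canonical homomorphism is given as a definite description.  Here it is identified with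
  the map induced on cohomology by the form-level map, for which vanishing can be checked
  without solving \<open>d\<eta> = \<omega>\<close>.
\<close>

lemma
  fixes m :: nat and f :: "nat \<Rightarrow> complex poly poly"
  defines "U \<equiv> arr_complement m f"
  shows canonical_hom_eq: "canonical_hom m f =
      (\<lambda>a\<in>carrier (ext_alg m). cohom_class U (form_hom U m (\<lambda>i. log_form U (f i)) a))"
    and canonical_hom_graded: "graded_alg_hom (ext_alg m) (ext_grading m)
      (cohom U) (cohom_grading U) (canonical_hom m f)"
proof -
  have U: "open U" unfolding U_def by (rule open_arr_complement)
  let ?F = "form_hom U m (\<lambda>i. log_form U (f i))"
  let ?E = "ext_alg m"
  define \<Phi> where "\<Phi> = (\<lambda>a\<in>carrier ?E. cohom_class U (?F a))"
  interpret E: complex_alg ?E by (rule complex_alg_ext_alg)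
  interpret Z: complex_alg "closed_forms U" by (rule complex_alg_closed_forms[OF U])
  have "graded_alg_hom ?E (ext_grading m) (closed_forms U) (closed_grading U) ?F"
    by (rule form_hom_graded[OF U log_form_degree[OF U] log_form_closed[OF U]])
       (simp add: U_def eval2_nonzero)
  from graded_alg_hom_comp[OF this Z.coset_graded_alg_hom[OF ideal_exact_forms[OF U]]]
  have "graded_alg_hom ?E (ext_grading m) (cohom U) (cohom_grading U) (\<lambda>a. cohom_class U (?F a))"
    by (simp add: cohom_def cohom_grading_def cohom_class_def)
  from E.graded_alg_hom_restrict[OF this ext_grading_carrier]
  have hom: "graded_alg_hom ?E (ext_grading m) (cohom U) (cohom_grading U) \<Phi>"
    by (simp add: \<Phi>_def)
  have gen: "\<Phi> (ext_monom {i}) = cohom_class U (log_form U (f i))" if "i < m" for i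
  proof -
    have c: "log_form U (f i) x \<in> carrier (ext_alg 4)" for x
      using log_form_degree[OF U, of "f i" x] ext_grading_carrier by blast
    have "?F (ext_monom {i}) = log_form U (f i)"
    proof
      fix x
      have "ordered_prod (\<lambda>i. log_form U (f i) x) {i} = log_form U (f i) x"
        using ordered_prod_insert_min[of "{}" i "\<lambda>i. log_form U (f i) x"] ext_mult_one_right[OF c] by simp
      moreover have "log_form U (f i) x = (\<lambda>S. 0)" if "x \<notin> U"
        using that by (simp add: log_form_def ext_deriv_outside fun_eq_iff)
      ultimately show "?F (ext_monom {i}) x = log_form U (f i) x"
        using that by (cases "x \<in> U") (simp_all add: form_hom_def ext_hom_monom)
    qed
    then show ?thesis using that by (simp add: \<Phi>_def ext_monom_carrier)
  qed
  have ext: "\<Phi> \<in> extensional (carrier ?E)" unfolding \<Phi>_def by (rule restrict_extensional)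
  have eq: "canonical_hom m f = \<Phi>"
    unfolding canonical_hom_def Let_def U_def[symmetric]
  proof (rule the_equality)
    show "\<Phi> \<in> extensional (carrier ?E) \<and>
        graded_alg_hom ?E (ext_grading m) (cohom U) (cohom_grading U) \<Phi> \<and>
        (\<forall>i<m. \<Phi> (ext_monom {i}) = cohom_class U (log_form U (f i)))"
      by (intro conjI allI impI ext hom gen)
  next
    fix \<Psi> assume \<Psi>: "\<Psi> \<in> extensional (carrier ?E) \<and>
        graded_alg_hom ?E (ext_grading m) (cohom U) (cohom_grading U) \<Psi> \<and>
        (\<forall>i<m. \<Psi> (ext_monom {i}) = cohom_class U (log_form U (f i)))"
    show "\<Psi> = \<Phi>"
    proof (rule extensionalityI)
      fix a assume a: "a \<in> carrier ?E"
      have "\<Psi> (ext_monom {i}) = \<Phi> (ext_monom {i})" if "i < m" for i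
        using \<Psi>[THEN conjunct2, THEN conjunct2, rule_format, OF that] gen[OF that] by (simp only:)
      then show "\<Psi> a = \<Phi> a"
        by (rule ext_alg_hom_unique[OF \<Psi>[THEN conjunct2, THEN conjunct1] hom _ a])
    qed (rule \<Psi>[THEN conjunct1], rule ext)
  qed
  show "canonical_hom m f =
      (\<lambda>a\<in>carrier ?E. cohom_class U (form_hom U m (\<lambda>i. log_form U (f i)) a))"
    unfolding eq \<Phi>_def ..
  show "graded_alg_hom ?E (ext_grading m) (cohom U) (cohom_grading U) (canonical_hom m f)"
    unfolding eq by (rule hom)
qed

text \<open>
  Only nodes with \<open>k\<^sub>x \<ge> 4\<close> contribute relations.  The derivative of a monomial of degree \<open>k\<^sub>x\<close>
  has degree \<open>k\<^sub>x - 1 \<ge> 3\<close>, where the homomorphism is zero on the level of forms.  For \<open>k\<^sub>x = 3\<close> the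
  relation has degree two, and this argument breaks down.
\<close>

theorem theorem6p23:
  fixes m :: nat and f :: "nat \<Rightarrow> complex poly poly"
  assumes "curve_arrangement m f"
    and "\<And>x. is_node m f x \<Longrightarrow> node_mult m f x \<noteq> 3"
  shows "canonical_hom m f ` relation_ideal m f = {\<zero>\<^bsub>cohom (arr_complement m f)\<^esub>} \<and>
    (\<exists>\<Psi>. graded_alg_hom (OS_alg m f) (OS_grading m f)
            (cohom (arr_complement m f)) (cohom_grading (arr_complement m f)) \<Psi> \<and>
          (\<forall>a\<in>carrier (ext_alg m).
             canonical_hom m f a = \<Psi> (relation_ideal m f +>\<^bsub>ext_alg m\<^esub> a)))"
proof -
  define U where "U = arr_complement m f"
  have U: "open U" unfolding U_def by (rule open_arr_complement)
  let ?E = "ext_alg m" and ?H = "cohom U" and ?I = "relation_ideal m f" and ?\<Phi> = "canonical_hom m f"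
  interpret E: complex_alg ?E by (rule complex_alg_ext_alg)
  interpret Z: complex_alg "closed_forms U" by (rule complex_alg_closed_forms[OF U])
  have H: "ring ?H" unfolding cohom_def by (rule Z.ring_alg_quot[OF ideal_exact_forms[OF U]])
  have hom: "graded_alg_hom ?E (ext_grading m) ?H (cohom_grading U) ?\<Phi>"
    unfolding U_def by (rule canonical_hom_graded)
  then interpret \<Phi>: ring_hom_ring ?E ?H ?\<Phi>
    by (intro ring_hom_ringI2 E.ring_axioms H) (simp add: graded_alg_hom_def)
  let ?R = "{koszul m (ext_monom (curves_through m f x)) | x. is_node m f x \<and> 3 \<le> node_mult m f x}"
  have rel: "r \<in> carrier ?E \<and> ?\<Phi> r = \<zero>\<^bsub>?H\<^esub>" if "r \<in> ?R" for r
  proof -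
    from that obtain x where x: "r = koszul m (ext_monom (curves_through m f x))"
      "is_node m f x" "3 \<le> node_mult m f x" by auto
    with assms(2) have "4 \<le> node_mult m f x" by fastforce
    then obtain p where p: "node_mult m f x = Suc p" "3 \<le> p" by (cases "node_mult m f x") auto
    have "curves_through m f x \<subseteq> {..<m}" by (auto simp: curves_through_def)
    then have "ext_monom (curves_through m f x) \<in> ext_grading m (Suc p)"
      using ext_monom_grading p(1) by (metis node_mult_def)
    then have r: "r \<in> ext_grading m p" unfolding x(1) by (rule koszul_degree)
    then have rc: "r \<in> carrier ?E" using ext_grading_carrier by blast
    have "?\<Phi> r = cohom_class U (\<lambda>x S. 0)"
      using rc by (simp add: canonical_hom_eq U_def[symmetric] form_hom_vanish[OF U r p(2)])
    also have "\<dots> = exact_forms U"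
      by (simp add: cohom_class_def a_r_coset_def')
    also have "\<dots> = \<zero>\<^bsub>?H\<^esub>" by (simp add: cohom_def alg_quot_def FactRing_def)
    finally show ?thesis using rc by simp
  qed
  have gen: "?R \<subseteq> carrier ?E" using rel by blast
  have I: "ideal ?I ?E" unfolding relation_ideal_def by (rule E.genideal_ideal[OF gen])
  have "?R \<subseteq> a_kernel ?E ?H ?\<Phi>" unfolding a_kernel_def' using rel by blast
  then have ker: "?I \<subseteq> a_kernel ?E ?H ?\<Phi>"
    unfolding relation_ideal_def by (rule E.genideal_minimal[OF \<Phi>.kernel_is_ideal])
  have van: "?\<Phi> a = \<zero>\<^bsub>?H\<^esub>" if "a \<in> ?I" for a
    using subsetD[OF ker that] unfolding a_kernel_def' by simp
  have "\<zero>\<^bsub>?E\<^esub> \<in> ?I" using I by (rule additive_subgroup.zero_closed[OF ideal.axioms(1)])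
  then have "?I \<noteq> {}" by blast
  then have "?\<Phi> ` ?I = {\<zero>\<^bsub>?H\<^esub>}" using image_cong[OF refl van, of ?I] by (simp add: image_constant_conv)
  moreover have "\<exists>\<Psi>. graded_alg_hom (OS_alg m f) (OS_grading m f) ?H (cohom_grading U) \<Psi> \<and>
      (\<forall>a\<in>carrier ?E. ?\<Phi> a = \<Psi> (?I +>\<^bsub>?E\<^esub> a))"
    unfolding OS_alg_def OS_grading_def
    by (rule E.graded_alg_hom_factor[OF I hom H ext_grading_carrier van])
  ultimately show ?thesis unfolding U_def by blast
qed

end
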